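(* Let $N\ge1$ be an integer, $q=e^{2\pi i/N}$, and let $\alpha>-1$ be a real number. Let $R_kf(z)=f(q^k/z)$, $T_kf(z)=f(q^kz)$, let $\mathcal I$ be the identity, and put $$B_k(z)=\frac{2(2\alpha+1)q^kz^2}{(q^k-z^2)^2},\qquad C(z)=z\left[1+N(2\alpha+1)+\frac{2N(2\alpha+1)}{z^{2N}-1}\right],$$ $$\hat B_k(z)=\frac{q^{2k}-z^2}{q^k(z^2-1)}\,B_k(z),\qquad \hat C(z)=C(z)+\frac{2z(z^2+1)}{z^2-1}.$$ Let $\hat H(N)$ be the operator defined in the context. Then the sieved ultraspherical polynomials of the second kind $Q_n(x;N)$ satisfy the eigenvalue equation $$\hat H(N)Q_n(z+1/z;N)=n\bigl(n+(2\alpha+1)N+2\bigr)Q_n(z+1/z;N),\qquad n=0,1,2,\dots,$$ where $\hat H(N)$ takes equivalently (on symmetric Laurent polynomials, $f(z)=f(1/z)$) one of the following two forms: $$\hat H(N)=z^2\partial_z^2+\hat C(z)\partial_z+\sum_{k=0}^{N-1}\hat B_k(z)(R_k-\mathcal I),$$ $$\hat H(N)=z^2\partial_z^2+\hat C(z)\partial_z+\sum_{k=1}^{N-1}\hat B_k(z)(T_{-k}-\mathcal I).$$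
   Context: The sieved ultraspherical polynomials of the second kind are the sieved Jacobi polynomials of the second kind with $\beta=\alpha$, defined as follows. Let $a_n=-\dfrac{(\alpha+1/2)(1+(-1)^{n+1})}{n+2\alpha+2}$, $n=0,1,2,\dots$, and let $a_n(N)=a_{k-1}$ if $n=Nk-1$ for some integer $k\ge1$, and $a_n(N)=0$ otherwise. Define $\Phi_0(z;N)=1$, $\Phi_{n+1}(z;N)=z\Phi_n(z;N)-a_n(N)\,z^n\Phi_n(1/z;N)$. Then $Q_n(x;N)$ is the monic polynomial of degree $n$ in $x$ determined by $$Q_n(z+z^{-1};N)=\frac{z^{-n}\Phi_{2n+1}(z;N)-z^{n}\Phi_{2n+1}(1/z;N)}{z-z^{-1}}\quad(n\ge0).$$ The operator $\hat H(N)$ is $$\hat H(N)=(z-z^{-1})^{-1}H(N)(z-z^{-1})-\bigl(N(2\alpha+1)+1\bigr)\mathcal I,$$ where $(z-z^{-1})^{\pm1}$ act by multiplication, $H(N)=L(N)^2-N(2\alpha+1)L(N)$ and $L(N)=z\partial_z+\sum_{k=0}^{N-1}\dfrac{(2\alpha+1)z^2}{q^k-z^2}(R_k-\mathcal I)$. *)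

theory Defs
  imports "HOL-Analysis.Analysis" "HOL-Computational_Algebra.Polynomial"
begin

definition ultra_a :: "real \<Rightarrow> nat \<Rightarrow> real" where
  "ultra_a \<alpha> n = - ((\<alpha> + 1/2) * (1 + (-1) ^ (n + 1))) / (real n + 2 * \<alpha> + 2)"

text \<open>\<open>n = N k - 1\<close> with \<open>k \<ge> 1\<close> holds iff \<open>N\<close> divides \<open>n + 1\<close>, and then \<open>k = (n + 1) / N\<close>.\<close>

definition sieved_a :: "real \<Rightarrow> nat \<Rightarrow> nat \<Rightarrow> real" where
  "sieved_a \<alpha> N n = (if N dvd n + 1 then ultra_a \<alpha> ((n + 1) div N - 1) else 0)"

text \<open>The term \<open>z\<^sup>n \<Phi>\<^sub>n(1/z)\<close> is the reflection of \<open>\<Phi>\<^sub>n\<close>, because \<open>\<Phi>\<^sub>n\<close> has degree exactly \<open>n\<close>;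
  see \<open>poly_sieved_Phi_Suc\<close> below.\<close>

primrec sieved_Phi :: "real \<Rightarrow> nat \<Rightarrow> nat \<Rightarrow> complex poly" where
  "sieved_Phi \<alpha> N 0 = 1"
| "sieved_Phi \<alpha> N (Suc n) =
     pCons 0 (sieved_Phi \<alpha> N n)
       - smult (complex_of_real (sieved_a \<alpha> N n)) (reflect_poly (sieved_Phi \<alpha> N n))"

lemma sieved_Phi_monic:
  "degree (sieved_Phi \<alpha> N n) = n \<and> lead_coeff (sieved_Phi \<alpha> N n) = 1"
proof (induction n)
  case 0
  show ?case by simp
next
  case (Suc n)
  let ?P = "sieved_Phi \<alpha> N n"
  let ?r = "smult (complex_of_real (sieved_a \<alpha> N n)) (reflect_poly ?P)"
  have nz: "?P \<noteq> 0" using Suc by auto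
  have dr: "degree ?r \<le> n"
    by (metis Suc degree_reflect_poly_le degree_smult_le order_trans)
  have le: "degree (sieved_Phi \<alpha> N (Suc n)) \<le> Suc n"
    using Suc nz dr by (auto intro!: degree_diff_le)
  have co: "coeff (sieved_Phi \<alpha> N (Suc n)) (Suc n) = 1"
  proof -
    have "coeff ?r (Suc n) = 0" using dr by (intro coeff_eq_0) simp
    moreover have "coeff ?P n = 1" using Suc by metis
    ultimately show ?thesis by (simp del: coeff_smult)
  qed
  show ?case
    using le co le_degree[of "sieved_Phi \<alpha> N (Suc n)" "Suc n"] by (metis le_antisym one_neq_zero)
qed

lemma poly_sieved_Phi_Suc:
  assumes "z \<noteq> 0"
  shows "poly (sieved_Phi \<alpha> N (Suc n)) z =
           z * poly (sieved_Phi \<alpha> N n) z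
             - complex_of_real (sieved_a \<alpha> N n) * z ^ n * poly (sieved_Phi \<alpha> N n) (1 / z)"
  using assms sieved_Phi_monic[of \<alpha> N n]
  by (simp add: poly_reflect_poly_nz inverse_eq_divide)

definition sieved_Q :: "real \<Rightarrow> nat \<Rightarrow> nat \<Rightarrow> complex poly" where
  "sieved_Q \<alpha> N n = (THE Q. degree Q = n \<and> lead_coeff Q = 1 \<and>
     (\<forall>z. z \<noteq> 0 \<and> z\<^sup>2 \<noteq> 1 \<longrightarrow>
        poly Q (z + 1 / z) =
          (poly (sieved_Phi \<alpha> N (2 * n + 1)) z / z ^ n
             - z ^ n * poly (sieved_Phi \<alpha> N (2 * n + 1)) (1 / z)) / (z - 1 / z)))"

text \<open>Operators act on functions on the complex plane. Their values are meaningful only at points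
  \<open>z\<close> with \<open>z \<noteq> 0\<close> and \<open>z\<^bsup>2N\<^esup> \<noteq> 1\<close>, where no denominator vanishes. These points form an open
  set that is invariant under \<open>z \<mapsto> q\<^sup>k/z\<close> and \<open>z \<mapsto> q\<^sup>k z\<close>, so at such points
  compositions of the operators are not affected by values at the exceptional points.\<close>

definition q_root :: "nat \<Rightarrow> complex" where
  "q_root N = exp (2 * of_real pi * \<i> / of_nat N)"

definition R_op :: "nat \<Rightarrow> nat \<Rightarrow> (complex \<Rightarrow> complex) \<Rightarrow> complex \<Rightarrow> complex" where
  "R_op N k f z = f (q_root N ^ k / z)"

definition T_op :: "nat \<Rightarrow> int \<Rightarrow> (complex \<Rightarrow> complex) \<Rightarrow> complex \<Rightarrow> complex" where
  "T_op N k f z = f (q_root N powi k * z)"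

definition L_op :: "real \<Rightarrow> nat \<Rightarrow> (complex \<Rightarrow> complex) \<Rightarrow> complex \<Rightarrow> complex" where
  "L_op \<alpha> N f z = z * deriv f z +
     (\<Sum>k=0..<N. of_real (2 * \<alpha> + 1) * z\<^sup>2 / (q_root N ^ k - z\<^sup>2) * (R_op N k f z - f z))"

definition H_op :: "real \<Rightarrow> nat \<Rightarrow> (complex \<Rightarrow> complex) \<Rightarrow> complex \<Rightarrow> complex" where
  "H_op \<alpha> N f z =
     L_op \<alpha> N (L_op \<alpha> N f) z - of_real (real N * (2 * \<alpha> + 1)) * L_op \<alpha> N f z"

definition H_hat :: "real \<Rightarrow> nat \<Rightarrow> (complex \<Rightarrow> complex) \<Rightarrow> complex \<Rightarrow> complex" where
  "H_hat \<alpha> N f z =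
     inverse (z - 1 / z) * H_op \<alpha> N (\<lambda>w. (w - 1 / w) * f w) z
       - of_real (real N * (2 * \<alpha> + 1) + 1) * f z"

definition B_coef :: "real \<Rightarrow> nat \<Rightarrow> nat \<Rightarrow> complex \<Rightarrow> complex" where
  "B_coef \<alpha> N k z =
     2 * of_real (2 * \<alpha> + 1) * q_root N ^ k * z\<^sup>2 / (q_root N ^ k - z\<^sup>2)\<^sup>2"

definition C_coef :: "real \<Rightarrow> nat \<Rightarrow> complex \<Rightarrow> complex" where
  "C_coef \<alpha> N z =
     z * (1 + of_nat N * of_real (2 * \<alpha> + 1)
            + 2 * of_nat N * of_real (2 * \<alpha> + 1) / (z ^ (2 * N) - 1))"

definition B_hat :: "real \<Rightarrow> nat \<Rightarrow> nat \<Rightarrow> complex \<Rightarrow> complex" where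
  "B_hat \<alpha> N k z =
     (q_root N ^ (2 * k) - z\<^sup>2) / (q_root N ^ k * (z\<^sup>2 - 1)) * B_coef \<alpha> N k z"

definition C_hat :: "real \<Rightarrow> nat \<Rightarrow> complex \<Rightarrow> complex" where
  "C_hat \<alpha> N z = C_coef \<alpha> N z + 2 * z * (z\<^sup>2 + 1) / (z\<^sup>2 - 1)"

definition H_hat_R :: "real \<Rightarrow> nat \<Rightarrow> (complex \<Rightarrow> complex) \<Rightarrow> complex \<Rightarrow> complex" where
  "H_hat_R \<alpha> N f z =
     z\<^sup>2 * deriv (deriv f) z + C_hat \<alpha> N z * deriv f z
       + (\<Sum>k=0..<N. B_hat \<alpha> N k z * (R_op N k f z - f z))"

definition H_hat_T :: "real \<Rightarrow> nat \<Rightarrow> (complex \<Rightarrow> complex) \<Rightarrow> complex \<Rightarrow> complex" where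
  "H_hat_T \<alpha> N f z =
     z\<^sup>2 * deriv (deriv f) z + C_hat \<alpha> N z * deriv f z
       + (\<Sum>k=1..<N. B_hat \<alpha> N k z * (T_op N (- int k) f z - f z))"

definition laurent_polynomial :: "(complex \<Rightarrow> complex) \<Rightarrow> bool" where
  "laurent_polynomial f \<longleftrightarrow>
     (\<exists>(c :: int \<Rightarrow> complex) (m :: nat). \<forall>z. z \<noteq> 0 \<longrightarrow>
        f z = (\<Sum>k = - int m..int m. c k * z powi k))"

definition symmetric_laurent :: "(complex \<Rightarrow> complex) \<Rightarrow> bool" where
  "symmetric_laurent f \<longleftrightarrow> laurent_polynomial f \<and> (\<forall>z. z \<noteq> 0 \<longrightarrow> f z = f (1 / z))"

end

theory Submission
  imports Defs "HOL-Complex_Analysis.Cauchy_Integral_Formula"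
begin

text \<open>Write \<open>c = 2 \<alpha> + 1\<close> and let \<open>U\<close> be the set of the \<open>N\<close>-th roots of unity, so that
  sums over the powers of \<open>q\<close> are sums over \<open>U\<close>.

  The operator \<open>H = L\<^sup>2 - N c L\<close> looks like a second-order operator with two layers of reflections,
  but it collapses. In \<open>L\<^sup>2 f\<close> the derivatives at reflected points cancel, and the coefficient of
  \<open>f (x z)\<close> with \<open>x \<in> U\<close> and \<open>x \<noteq> 1\<close> is a multiple of a difference of two values of
  \<open>\<Sum>u\<in>U. w / (u - w)\<close>, which depends only on \<open>w\<^bsup>N\<^esup>\<close> and so does not see the rotation. What remains
  is \<open>z\<^sup>2 f'' + C f' + (\<Sum>u\<in>U. B\<^sub>u (f (u / z) - f z))\<close>
  (\<open>H_op_second_order\<close>); the coefficient of \<open>f z\<close> is forced by \<open>H 1 = 0\<close>.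
  In this form \<open>H\<close> visibly commutes with \<open>z \<mapsto> 1 / z\<close> (\<open>H_op_inversion\<close>).

  For the eigenvalues, the polynomials \<open>\<Phi>\<^sub>n\<close> satisfy a first-order equation that involves the
  reflected polynomial (\<open>sieved_Phi_differential_reflection\<close>); it follows from the recurrence by
  induction, since only the indices \<open>n\<close> with \<open>2 N\<close> dividing \<open>n + 1\<close> have a nonzero coefficient. Together
  with \<open>\<Phi>\<^sub>n (u z) = u\<^sup>n \<Phi>\<^sub>n z\<close> for \<open>u \<in> U\<close> the equation says that \<open>\<psi> = z\<^bsup>-n\<^esup> \<Phi>\<^sub>2\<^sub>n\<^sub>+\<^sub>1\<close> is an eigenfunction of
  \<open>L\<close> with eigenvalue \<open>n + 1 + N c\<close> (\<open>L_op_cmv_function\<close>). Hence \<open>H \<psi> = (n + 1) (n + 1 + N c) \<psi>\<close>,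
  and by the inversion symmetry the same holds for \<open>\<psi> (1 / z)\<close>. The difference
  \<open>\<psi> z - \<psi> (1 / z)\<close> is \<open>(z - 1 / z) Q\<^sub>n (z + 1 / z)\<close>, which gives the eigenvalue equation.

  The explicit forms come from conjugating the second-order form of \<open>H\<close> with \<open>z - 1 / z\<close>. Again
  only the coefficient of \<open>f z\<close> is not immediate, and it is fixed by the case \<open>n = 0\<close> of the eigenvalue
  equation: the conjugated operator annihilates \<open>Q\<^sub>0 = 1\<close>. On symmetric functions
  \<open>f (q\<^sup>k / z) = f (q\<^bsup>-k\<^esup> z)\<close>, so reflections may be replaced by rotations.\<close>

section \<open>Sums over roots of unity\<close>

definition unity_roots :: "nat \<Rightarrow> complex set" where
  "unity_roots N = {u. u ^ N = 1}"

lemma q_root_power_eq_cis: "q_root N ^ k = cis (2 * pi * real k / real N)"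
proof -
  have "q_root N = cis (2 * pi / real N)"
    unfolding q_root_def cis_conv_exp by (simp add: mult.commute mult.left_commute)
  then show ?thesis by (simp add: Complex.DeMoivre mult.commute mult.left_commute)
qed

lemma sum_q_root_eq_sum_unity_roots:
  assumes "N \<ge> 1"
  shows "(\<Sum>k=0..<N. F (q_root N ^ k)) = (\<Sum>u\<in>unity_roots N. F u)"
  unfolding q_root_power_eq_cis atLeast0LessThan unity_roots_def
  using sum.reindex_bij_betw[OF Complex.bij_betw_roots_unity[of N], of F] assms by simp

lemma finite_unity_roots: "N \<ge> 1 \<Longrightarrow> finite (unity_roots N)"
  unfolding unity_roots_def by (rule finite_roots_unity)

lemma card_unity_roots: "N \<ge> 1 \<Longrightarrow> card (unity_roots N) = N"
  unfolding unity_roots_def by (rule card_roots_unity_eq) simp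

lemma unity_roots_nonzero: "N \<ge> 1 \<Longrightarrow> u \<in> unity_roots N \<Longrightarrow> u \<noteq> 0"
  unfolding unity_roots_def by (auto simp: power_0_left)

lemma sum_unity_roots_times:
  assumes "N \<ge> 1" "v \<in> unity_roots N"
  shows "(\<Sum>u\<in>unity_roots N. F (v * u)) = (\<Sum>u\<in>unity_roots N. F u)"
proof (rule sum.reindex_bij_betw)
  have "v \<noteq> 0" using unity_roots_nonzero assms by blast
  then show "bij_betw ((*) v) (unity_roots N) (unity_roots N)"
    by (intro bij_betwI[where g = "\<lambda>u. u / v"])
       (use assms in \<open>auto simp: unity_roots_def power_mult_distrib power_divide\<close>)
qed

lemma sum_unity_roots_inverse:
  assumes "N \<ge> 1"
  shows "(\<Sum>u\<in>unity_roots N. F (1 / u)) = (\<Sum>u\<in>unity_roots N. F u)"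
  by (rule sum.reindex_bij_betw, rule bij_betwI[where g = "\<lambda>u. 1 / u"])
     (auto simp: unity_roots_def power_divide)

lemma sum_unity_roots_power:
  assumes "N \<ge> 1"
  shows "(\<Sum>u\<in>unity_roots N. u ^ e) = (if N dvd e then of_nat N else 0)"
proof (cases "N dvd e")
  case True
  then obtain d where "e = N * d" by blast
  then have "(\<Sum>u\<in>unity_roots N. u ^ e) = (\<Sum>u\<in>unity_roots N. 1)"
    by (intro sum.cong) (auto simp: unity_roots_def power_mult)
  then show ?thesis using True card_unity_roots[OF assms] by simp
next
  case False
  define v where "v = q_root N"
  have "v ^ N = cis (2 * pi)"
    using q_root_power_eq_cis[of N N] assms by (simp add: v_def)
  then have vU: "v \<in> unity_roots N" by (simp add: unity_roots_def)
  have "v ^ e \<noteq> 1"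
  proof
    assume "v ^ e = 1"
    then have "cis (2 * pi * real e / real N) = 1"
      using q_root_power_eq_cis[of N e] by (simp add: v_def)
    then have "cos (2 * pi * real e / real N) = 1" by (metis cis.sel(1) one_complex.sel(1))
    then obtain x :: int where "2 * pi * real e / real N = of_int x * 2 * pi"
      unfolding cos_one_2pi_int by blast
    then have "real e = of_int x * real N" using assms by (simp add: field_simps)
    then have "int e = x * int N" by (metis of_int_eq_iff of_int_mult of_int_of_nat_eq)
    then have "int N dvd int e" by simp
    then show False using False by simp
  qed
  moreover have "(\<Sum>u\<in>unity_roots N. u ^ e) = v ^ e * (\<Sum>u\<in>unity_roots N. u ^ e)"
    using sum_unity_roots_times[OF assms vU, of "\<lambda>u. u ^ e"]
    by (simp add: power_mult_distrib sum_distrib_left)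
  ultimately show ?thesis using False by simp
qed

text \<open>Expand \<open>(u\<^sup>N - w\<^sup>N) / (u - w)\<close> with \<open>u\<^sup>N = 1\<close> and sum over \<open>u\<close>: of the \<open>N\<close> consecutive powers of
  \<open>u\<close> that occur, only \<open>u\<^sup>N\<close> has a nonzero sum.\<close>

lemma sum_unity_roots_resolvent:
  fixes w :: complex
  assumes "N \<ge> 1" "1 \<le> s" "s \<le> N" "w ^ N \<noteq> 1"
  shows "(\<Sum>u\<in>unity_roots N. u ^ s / (u - w)) = of_nat N * w ^ (s - 1) / (1 - w ^ N)"
proof -
  have summand: "u ^ s / (u - w) * (1 - w ^ N) = (\<Sum>i<N. w ^ i * u ^ (N - 1 - i + s))"
    if "u \<in> unity_roots N" for u
  proof -
    have "u \<noteq> w" "u ^ N = 1" using that assms(4) by (auto simp: unity_roots_def)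
    have "1 - w ^ N = (u - w) * (\<Sum>i<N. w ^ (N - Suc i) * u ^ i)"
      using power_diff_sumr2[of u N w] \<open>u ^ N = 1\<close> by simp
    also have "(\<Sum>i<N. w ^ (N - Suc i) * u ^ i) = (\<Sum>i<N. w ^ i * u ^ (N - 1 - i))"
      by (subst sum.nat_diff_reindex[symmetric]) (rule sum.cong, auto)
    finally have "u ^ s / (u - w) * (1 - w ^ N) = u ^ s * (\<Sum>i<N. w ^ i * u ^ (N - 1 - i))"
      using \<open>u \<noteq> w\<close> by simp
    then show ?thesis
      by (simp only: sum_distrib_left power_add mult_ac)
  qed
  have "(\<Sum>u\<in>unity_roots N. u ^ s / (u - w)) * (1 - w ^ N)
      = (\<Sum>u\<in>unity_roots N. \<Sum>i<N. w ^ i * u ^ (N - 1 - i + s))"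
    unfolding sum_distrib_right by (rule sum.cong, simp, rule summand)
  also have "\<dots> = (\<Sum>i<N. w ^ i * (\<Sum>u\<in>unity_roots N. u ^ (N - 1 - i + s)))"
    by (subst sum.swap) (simp add: sum_distrib_left)
  also have "\<dots> = (\<Sum>i<N. if i = s - 1 then w ^ i * of_nat N else 0)"
  proof (rule sum.cong)
    fix i assume "i \<in> {..<N}"
    have "N dvd N - 1 - i + s \<longleftrightarrow> i = s - 1"
    proof
      assume "N dvd N - 1 - i + s"
      then obtain d where d: "N - 1 - i + s = N * d" by blast
      have "0 < N * d" "N * d < N * 2"
        unfolding d[symmetric] using assms \<open>i \<in> {..<N}\<close> by auto
      then have "d = 1" by (auto simp: mult_less_cancel1)
      then show "i = s - 1" using d assms \<open>i \<in> {..<N}\<close> by auto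
    qed (use assms in auto)
    then show "w ^ i * (\<Sum>u\<in>unity_roots N. u ^ (N - 1 - i + s))
        = (if i = s - 1 then w ^ i * of_nat N else 0)"
      by (simp add: sum_unity_roots_power[OF assms(1)])
  qed simp
  also have "\<dots> = of_nat N * w ^ (s - 1)" using assms by (simp add: sum.delta)
  finally show ?thesis using assms(4) by (simp add: field_simps)
qed

section \<open>The operators away from their singularities\<close>

text \<open>The points where no coefficient of the operators has a pole. The set is open and preserved by
  the maps \<open>z \<mapsto> u / z\<close>, so the values of \<open>L f\<close> and \<open>H f\<close> on it depend only on the values of \<open>f\<close> on it (\<open>L_op_cong\<close>, \<open>H_op_cong\<close>).\<close>

definition regular_points :: "nat \<Rightarrow> complex set" where
  "regular_points N = {z. z \<noteq> 0 \<and> z ^ (2 * N) \<noteq> 1}"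

lemma open_regular_points: "open (regular_points N)"
proof -
  have "regular_points N = (-{0}) \<inter> (\<lambda>z. z ^ (2 * N)) -` (-{1})"
    by (auto simp: regular_points_def)
  then show ?thesis by (auto intro!: open_Int open_vimage continuous_intros)
qed

lemma regular_points_rotate_reflect:
  assumes "z \<in> regular_points N" "u \<in> unity_roots N"
  shows "u / z \<in> regular_points N"
proof -
  have "z \<noteq> 0" "z ^ (2 * N) \<noteq> 1" and u: "u ^ N = 1"
    using assms by (auto simp: regular_points_def unity_roots_def)
  moreover have "N \<noteq> 0" using calculation by (cases N) auto
  moreover have "u \<noteq> 0" using u calculation by (auto simp: power_0_left)
  moreover have "(u / z) ^ (2 * N) = 1 / z ^ (2 * N)"
    by (simp add: power_divide mult.commute[of 2] power_mult u)
  ultimately show ?thesis by (auto simp: regular_points_def)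
qed

lemma regular_points_unity_roots:
  assumes "z \<in> regular_points N" "u \<in> unity_roots N"
  shows "u \<noteq> z\<^sup>2"
  using assms by (auto simp: regular_points_def unity_roots_def simp flip: power_mult)

abbreviation coupling :: "real \<Rightarrow> complex" where
  "coupling \<alpha> \<equiv> of_real (2 * \<alpha> + 1)"

lemma L_op_eq:
  assumes "N \<ge> 1"
  shows "L_op \<alpha> N f z = z * deriv f z +
    (\<Sum>u\<in>unity_roots N. coupling \<alpha> * z\<^sup>2 / (u - z\<^sup>2) * (f (u / z) - f z))"
  unfolding L_op_def R_op_def
  using sum_q_root_eq_sum_unity_roots[OF assms,
      of "\<lambda>u. coupling \<alpha> * z\<^sup>2 / (u - z\<^sup>2) * (f (u / z) - f z)"] by simp

lemma eventually_regular_points: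
  "z \<in> regular_points N \<Longrightarrow> eventually (\<lambda>w. w \<in> regular_points N) (nhds z)"
  using open_regular_points by (rule eventually_nhds_in_open)

lemma L_op_cong:
  assumes "N \<ge> 1" "z \<in> regular_points N" "\<And>w. w \<in> regular_points N \<Longrightarrow> f w = g w"
  shows "L_op \<alpha> N f z = L_op \<alpha> N g z"
proof -
  have "deriv f z = deriv g z"
    by (rule deriv_cong_ev[OF _ refl])
       (use eventually_regular_points[OF assms(2)] assms(3) in \<open>auto elim: eventually_mono\<close>)
  moreover have "(\<Sum>u\<in>unity_roots N. coupling \<alpha> * z\<^sup>2 / (u - z\<^sup>2) * (f (u / z) - f z))
      = (\<Sum>u\<in>unity_roots N. coupling \<alpha> * z\<^sup>2 / (u - z\<^sup>2) * (g (u / z) - g z))"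
    using assms(2,3) regular_points_rotate_reflect by (intro sum.cong) auto
  ultimately show ?thesis by (simp only: L_op_eq[OF assms(1)] assms(3)[OF assms(2)])
qed

lemma H_op_cong:
  assumes "N \<ge> 1" "z \<in> regular_points N" "\<And>w. w \<in> regular_points N \<Longrightarrow> f w = g w"
  shows "H_op \<alpha> N f z = H_op \<alpha> N g z"
proof -
  have "L_op \<alpha> N f w = L_op \<alpha> N g w" if "w \<in> regular_points N" for w
    by (rule L_op_cong) (use assms that in auto)
  then have "L_op \<alpha> N (L_op \<alpha> N f) z = L_op \<alpha> N (L_op \<alpha> N g) z" "L_op \<alpha> N f z = L_op \<alpha> N g z"
    using assms by (auto intro!: L_op_cong)
  then show ?thesis by (simp add: H_op_def)
qed

lemma has_field_derivative_punctured:
  assumes "f holomorphic_on -{0}" "(z::complex) \<noteq> 0"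
  shows "(f has_field_derivative deriv f z) (at z)"
  using assms by (intro holomorphic_derivI[of f "-{0}"]) auto

lemma deriv_L_op:
  assumes "N \<ge> 1" and f: "f holomorphic_on -{0}" and z: "z \<in> regular_points N"
  shows "deriv (L_op \<alpha> N f) z = deriv f z + z * deriv (deriv f) z +
    (\<Sum>u\<in>unity_roots N. 2 * coupling \<alpha> * u * z / (u - z\<^sup>2)\<^sup>2 * (f (u / z) - f z)
        + coupling \<alpha> * z\<^sup>2 / (u - z\<^sup>2) * (- (u / z\<^sup>2) * deriv f (u / z) - deriv f z))"
proof -
  have z0: "z \<noteq> 0" using z by (simp add: regular_points_def)
  note df = has_field_derivative_punctured[OF f z0]
  have ddf: "(deriv f has_field_derivative deriv (deriv f) z) (at z)"
    using f z0 by (intro has_field_derivative_punctured holomorphic_deriv) auto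
  have refl: "((\<lambda>z. f (u / z)) has_field_derivative - (u / z\<^sup>2) * deriv f (u / z)) (at z)"
    if "u \<in> unity_roots N" for u
  proof -
    have "u / z \<noteq> 0" using unity_roots_nonzero[OF assms(1) that] z0 by simp
    moreover have "((\<lambda>z. u / z) has_field_derivative - (u / z\<^sup>2)) (at z)"
      using z0 by (auto intro!: derivative_eq_intros simp: power2_eq_square)
    ultimately show ?thesis
      using DERIV_chain2[OF has_field_derivative_punctured[OF f]] by (metis mult.commute)
  qed
  have coef: "((\<lambda>z. coupling \<alpha> * z\<^sup>2 / (u - z\<^sup>2)) has_field_derivative
      2 * coupling \<alpha> * u * z / (u - z\<^sup>2)\<^sup>2) (at z)" if "u \<in> unity_roots N" for u
  proof -
    have "u - z\<^sup>2 \<noteq> 0" using regular_points_unity_roots[OF z that] by simp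
    then show ?thesis
      by (auto intro!: derivative_eq_intros simp: power2_eq_square) (simp add: divide_simps algebra_simps)
  qed
  have "((\<lambda>z. z * deriv f z +
      (\<Sum>u\<in>unity_roots N. coupling \<alpha> * z\<^sup>2 / (u - z\<^sup>2) * (f (u / z) - f z))) has_field_derivative
     (1 * deriv f z + deriv (deriv f) z * z) +
    (\<Sum>u\<in>unity_roots N. 2 * coupling \<alpha> * u * z / (u - z\<^sup>2)\<^sup>2 * (f (u / z) - f z)
        + (- (u / z\<^sup>2) * deriv f (u / z) - deriv f z) * (coupling \<alpha> * z\<^sup>2 / (u - z\<^sup>2)))) (at z)"
    by (intro DERIV_add DERIV_mult DERIV_ident ddf DERIV_sum coef DERIV_diff refl df)
  then have "deriv (\<lambda>z. z * deriv f z +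
      (\<Sum>u\<in>unity_roots N. coupling \<alpha> * z\<^sup>2 / (u - z\<^sup>2) * (f (u / z) - f z))) z =
     (1 * deriv f z + deriv (deriv f) z * z) +
    (\<Sum>u\<in>unity_roots N. 2 * coupling \<alpha> * u * z / (u - z\<^sup>2)\<^sup>2 * (f (u / z) - f z)
        + (- (u / z\<^sup>2) * deriv f (u / z) - deriv f z) * (coupling \<alpha> * z\<^sup>2 / (u - z\<^sup>2)))"
    by (rule DERIV_imp_deriv)
  then show ?thesis
    by (simp only: L_op_eq[OF assms(1), abs_def] mult_1 mult.commute[of "deriv (deriv f) z"]
        mult.commute[of "- _ * _ - _"])
qed

section \<open>The second-order form of H\<close>

text \<open>The value depends on \<open>w\<close> only through \<open>w\<^sup>N\<close>, hence does not change when \<open>w\<close> is multiplied by an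
  \<open>N\<close>-th root of unity. This invariance makes the mixed terms of \<open>L\<^sup>2\<close> vanish.\<close>

lemma sum_unity_roots_resolvent_weighted:
  assumes "N \<ge> 1" "w ^ N \<noteq> 1"
  shows "(\<Sum>u\<in>unity_roots N. w / (u - w)) = of_nat N * w ^ N / (1 - w ^ N)"
proof -
  have "(\<Sum>u\<in>unity_roots N. w / (u - w)) = w * (\<Sum>u\<in>unity_roots N. u ^ N / (u - w))"
    unfolding sum_distrib_left by (rule sum.cong) (auto simp: unity_roots_def)
  also have "\<dots> = w * (of_nat N * w ^ (N - 1) / (1 - w ^ N))"
    using sum_unity_roots_resolvent[of N N w] assms by simp
  also have "\<dots> = of_nat N * (w * w ^ (N - 1)) / (1 - w ^ N)" by simp
  also have "w * w ^ (N - 1) = w ^ N" using assms by (simp flip: power_Suc)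
  finally show ?thesis .
qed

text \<open>By partial fractions the sum is a multiple of the difference of the sums of \<open>w / (u - w)\<close> and of
  \<open>x w / (u - x w)\<close>, which agree because \<open>(x w)\<^sup>N = w\<^sup>N\<close>. Up to the factor \<open>c\<^sup>2\<close> it is the coefficient of
  the rotated value \<open>f (x z)\<close> in \<open>L\<^sup>2 f\<close>.\<close>

lemma sum_unity_roots_resolvent_product:
  assumes "N \<ge> 1" "w ^ N \<noteq> 1" "w \<noteq> 0" "x \<in> unity_roots N" "x \<noteq> 1"
  shows "(\<Sum>u\<in>unity_roots N. w / (u - w) * (u / (x * w - u))) = 0"
proof -
  have xw: "(x * w) ^ N = w ^ N" using assms by (simp add: unity_roots_def power_mult_distrib)
  have "(\<Sum>u\<in>unity_roots N. w / (u - w) * (u / (x * w - u)))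
      = (\<Sum>u\<in>unity_roots N. (w / (u - w) - x * w / (u - x * w)) / (x - 1))"
  proof (rule sum.cong)
    fix u assume u: "u \<in> unity_roots N"
    have "u - w \<noteq> 0" using u assms(2) by (auto simp: unity_roots_def)
    moreover have "u - x * w \<noteq> 0" using u assms(2) xw by (auto simp: unity_roots_def)
    moreover from this have "x * w - u \<noteq> 0" by auto
    moreover have "x - 1 \<noteq> 0" using assms by simp
    ultimately show "w / (u - w) * (u / (x * w - u))
        = (w / (u - w) - x * w / (u - x * w)) / (x - 1)"
      by (simp add: frac_eq_eq nonzero_eq_divide_eq nonzero_divide_eq_eq diff_frac_eq) (simp add: algebra_simps)
  qed simp
  also have "\<dots> = 0"
    using sum_unity_roots_resolvent_weighted[OF assms(1), of w]
      sum_unity_roots_resolvent_weighted[OF assms(1), of "x * w"] assms(2) xw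
    by (simp only: sum_divide_distrib[symmetric] sum_subtractf) simp
  finally show ?thesis .
qed

text \<open>In \<open>L\<^sup>2 f\<close> the terms with \<open>f' (u / z)\<close> cancel, since \<open>f (u / z)\<close> is differentiated with a
  minus sign (\<open>Y\<close> in the proof), and rotated values drop out by
  \<open>sum_unity_roots_resolvent_product\<close>. Subtracting \<open>N c L\<close> removes the first-power
  coefficients of \<open>f (u / z)\<close>, which leaves \<open>B u\<close>,
  the derivatives of the coefficients of \<open>L\<close> multiplied by \<open>z\<close>.
  The remaining multiple of \<open>f z\<close> is the same for all \<open>f\<close>, and is zero because \<open>H 1 = 0\<close>.\<close>

theorem H_op_second_order:
  assumes N: "N \<ge> 1" and f: "f holomorphic_on -{0}" and z: "z \<in> regular_points N"
  shows "H_op \<alpha> N f z = z\<^sup>2 * deriv (deriv f) z + C_coef \<alpha> N z * deriv f z +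
    (\<Sum>u\<in>unity_roots N. 2 * coupling \<alpha> * u * z\<^sup>2 / (u - z\<^sup>2)\<^sup>2 * (f (u / z) - f z))"
proof -
  let ?U = "unity_roots N" and ?c = "coupling \<alpha>"
  define w where "w = z\<^sup>2"
  \<comment> \<open>\<open>A u\<close> is the coefficient of \<open>f (u / z) - f z\<close> in \<open>L f\<close>, and \<open>B u\<close> is \<open>z\<close> times its derivative.\<close>
  define A where "A u = ?c * w / (u - w)" for u
  define B where "B u = 2 * ?c * u * w / (u - w)\<^sup>2" for u
  define \<sigma> where "\<sigma> = (\<Sum>u\<in>?U. A u)"
  define e where "e = (\<Sum>u\<in>?U. A u * (?c * (u / (w - u))))"
  have z0: "z \<noteq> 0" using z by (simp add: regular_points_def)
  have w0: "w \<noteq> 0" "w ^ N \<noteq> 1"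
    using z by (auto simp: w_def regular_points_def simp flip: power_mult)
  have \<sigma>: "\<sigma> = ?c * (of_nat N * w ^ N / (1 - w ^ N))"
    unfolding \<sigma>_def A_def sum_unity_roots_resolvent_weighted[OF N w0(2), symmetric]
    by (simp add: sum_distrib_left)
  have key: "H_op \<alpha> N g z = w * deriv (deriv g) z + (1 - 2 * \<sigma> - of_nat N * ?c) * (z * deriv g z)
      + (\<Sum>u\<in>?U. B u * (g (u / z) - g z)) + (e + \<sigma>\<^sup>2 + of_nat N * ?c * \<sigma>) * g z"
    if g: "g holomorphic_on -{0}" for g
  proof -
    define X where "X = (\<Sum>u\<in>?U. A u * g (u / z))"
    define Y where "Y = (\<Sum>u\<in>?U. A u * (u / z * deriv g (u / z)))"
    have L: "L_op \<alpha> N g z = z * deriv g z + X - \<sigma> * g z"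
      unfolding L_op_eq[OF N] w_def[symmetric] A_def[symmetric] X_def \<sigma>_def
      by (simp only: right_diff_distrib sum_subtractf sum_distrib_right add_diff_eq)
    have dL: "z * deriv (L_op \<alpha> N g) z = z * deriv g z + w * deriv (deriv g) z
        + (\<Sum>u\<in>?U. B u * (g (u / z) - g z)) - Y - \<sigma> * (z * deriv g z)"
    proof -
      have "z * (\<Sum>u\<in>?U. 2 * ?c * u * z / (u - z\<^sup>2)\<^sup>2 * (g (u / z) - g z)
          + ?c * z\<^sup>2 / (u - z\<^sup>2) * (- (u / z\<^sup>2) * deriv g (u / z) - deriv g z))
        = (\<Sum>u\<in>?U. B u * (g (u / z) - g z) - A u * (u / z * deriv g (u / z)) - A u * (z * deriv g z))"
        unfolding sum_distrib_left
      proof (rule sum.cong)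
        fix u assume "u \<in> ?U"
        have "z * (2 * ?c * u * z / (u - z\<^sup>2)\<^sup>2 * (g (u / z) - g z)) = B u * (g (u / z) - g z)"
          by (simp add: B_def w_def power2_eq_square)
        moreover have "z * (- (u / z\<^sup>2) * deriv g (u / z) - deriv g z)
            = - (u / z * deriv g (u / z)) - z * deriv g z"
          using z0 by (simp add: power2_eq_square field_simps)
        ultimately show "z * (2 * ?c * u * z / (u - z\<^sup>2)\<^sup>2 * (g (u / z) - g z)
          + ?c * z\<^sup>2 / (u - z\<^sup>2) * (- (u / z\<^sup>2) * deriv g (u / z) - deriv g z))
          = B u * (g (u / z) - g z) - A u * (u / z * deriv g (u / z)) - A u * (z * deriv g z)"
          unfolding distrib_left A_def w_def mult.left_commute[of z "?c * z\<^sup>2 / (u - z\<^sup>2)"]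
          by (simp only: right_diff_distrib mult_minus_right) (simp only: diff_conv_add_uminus add.assoc)
      qed simp
      also have "\<dots> = (\<Sum>u\<in>?U. B u * (g (u / z) - g z)) - Y - \<sigma> * (z * deriv g z)"
        by (simp only: sum_subtractf Y_def \<sigma>_def sum_distrib_right)
      finally show ?thesis
        by (simp only: deriv_L_op[OF N g z] distrib_left) (simp add: w_def power2_eq_square)
    qed
    \<comment> \<open>Reflecting twice is rotating: the substitution of \<open>u x\<close> for the summation variable in \<open>L g (u / z)\<close>
      turns the doubly reflected values into \<open>g (x z)\<close>.\<close>
    have Lr: "L_op \<alpha> N g (u / z) = u / z * deriv g (u / z)
        + (\<Sum>x\<in>?U. ?c * (u / (x * w - u)) * g (x * z)) + (of_nat N * ?c + \<sigma>) * g (u / z)"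
      if u: "u \<in> ?U" for u
    proof -
      have u0: "u \<noteq> 0" using unity_roots_nonzero[OF N u] .
      have "L_op \<alpha> N g (u / z) = u / z * deriv g (u / z) +
          (\<Sum>x\<in>?U. ?c * (u / z)\<^sup>2 / (u * x - (u / z)\<^sup>2) * (g (u * x / (u / z)) - g (u / z)))"
        by (simp only: L_op_eq[OF N] sum_unity_roots_times[OF N u,
              of "\<lambda>x. ?c * (u / z)\<^sup>2 / (x - (u / z)\<^sup>2) * (g (x / (u / z)) - g (u / z))"])
      also have "(\<Sum>x\<in>?U. ?c * (u / z)\<^sup>2 / (u * x - (u / z)\<^sup>2) * (g (u * x / (u / z)) - g (u / z)))
          = (\<Sum>x\<in>?U. ?c * (u / (x * w - u)) * (g (x * z) - g (u / z)))"
      proof (rule sum.cong)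
        fix x assume x: "x \<in> ?U"
        have "u \<noteq> x * w" 
          using u x w0 by (auto simp: unity_roots_def power_mult_distrib)
        then have "x * w - u \<noteq> 0" by auto
        moreover have "u * x - (u / z)\<^sup>2 = u * (x * w - u) / w"
          using z0 by (simp add: w_def field_simps power2_eq_square)
        ultimately have "(u / z)\<^sup>2 / (u * x - (u / z)\<^sup>2) = u / (x * w - u)"
          using u0 z0 by (simp add: w_def power_divide) (simp add: power2_eq_square)
        moreover have "u * x / (u / z) = x * z" using u0 z0 by simp
        ultimately show "?c * (u / z)\<^sup>2 / (u * x - (u / z)\<^sup>2) * (g (u * x / (u / z)) - g (u / z))
            = ?c * (u / (x * w - u)) * (g (x * z) - g (u / z))"
          by (simp only: times_divide_eq_right[symmetric])
      qed simp
      also have "\<dots> = (\<Sum>x\<in>?U. ?c * (u / (x * w - u)) * g (x * z))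
          - (\<Sum>x\<in>?U. ?c * (u / (x * w - u))) * g (u / z)"
        by (simp only: right_diff_distrib sum_subtractf sum_distrib_right)
      also have "(\<Sum>x\<in>?U. ?c * (u / (x * w - u))) = - (of_nat N * ?c + \<sigma>)"
      proof -
        have "(\<Sum>x\<in>?U. ?c * (u / (x * w - u))) = (\<Sum>x\<in>?U. ?c * (u / (u * (1 / x) * w - u)))"
          unfolding sum_unity_roots_inverse[OF N, of "\<lambda>x. ?c * (u / (u * x * w - u))"]
            sum_unity_roots_times[OF N u, of "\<lambda>x. ?c * (u / (x * w - u))"] ..
        also have "\<dots> = (\<Sum>x\<in>?U. - ?c - A x)"
        proof (rule sum.cong)
          fix x assume x: "x \<in> ?U"
          have "x - w \<noteq> 0" using x w0 by (auto simp: unity_roots_def)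
          then have frac: "x / (x - w) = 1 + w / (x - w)"
            by (simp add: field_simps)
          have "x \<noteq> 0" using unity_roots_nonzero[OF N x] .
          then have "u * (1 / x) * w - u = - (u * (x - w) / x)"
            by (simp add: field_simps)
          then have "u / (u * (1 / x) * w - u) = - (x / (x - w))"
            using u0 by simp
          then have "?c * (u / (u * (1 / x) * w - u)) = ?c * - (1 + w / (x - w))"
            by (simp only: frac)
          then show "?c * (u / (u * (1 / x) * w - u)) = - ?c - A x"
            by (simp only: A_def) (simp add: ring_distribs)
        qed simp
        also have "\<dots> = - (of_nat N * ?c + \<sigma>)"
          by (simp only: sum_subtractf \<sigma>_def sum_constant card_unity_roots[OF N]) (simp add: algebra_simps)
        finally show ?thesis .
      qed
      finally show ?thesis by (simp only: mult_minus_left diff_minus_eq_add add.assoc)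
    qed
    \<comment> \<open>Only the trivial rotation \<open>x = 1\<close> survives.\<close>
    have cross: "(\<Sum>u\<in>?U. A u * (\<Sum>x\<in>?U. ?c * (u / (x * w - u)) * g (x * z))) = e * g z"
    proof -
      have "(\<Sum>u\<in>?U. A u * (\<Sum>x\<in>?U. ?c * (u / (x * w - u)) * g (x * z)))
          = (\<Sum>x\<in>?U. (\<Sum>u\<in>?U. A u * (?c * (u / (x * w - u)))) * g (x * z))"
        unfolding sum_distrib_left sum_distrib_right by (subst sum.swap) (simp only: mult_ac)
      also have "\<dots> = (\<Sum>x\<in>?U. if x = 1 then e * g z else 0)"
      proof (rule sum.cong)
        fix x assume x: "x \<in> ?U"
        have "(\<Sum>u\<in>?U. A u * (?c * (u / (x * w - u)))) = 0" if "x \<noteq> 1"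
        proof -
          have "(\<Sum>u\<in>?U. A u * (?c * (u / (x * w - u))))
              = ?c * ?c * (\<Sum>u\<in>?U. w / (u - w) * (u / (x * w - u)))"
            by (simp add: A_def sum_distrib_left mult_ac)
          then show ?thesis by (simp only: sum_unity_roots_resolvent_product[OF N w0(2,1) x that] mult_zero_right)
        qed
        then show "(\<Sum>u\<in>?U. A u * (?c * (u / (x * w - u)))) * g (x * z)
            = (if x = 1 then e * g z else 0)"
          by (auto simp: e_def)
      qed simp
      also have "\<dots> = e * g z"
        using finite_unity_roots[OF N] by (simp add: unity_roots_def)
      finally show ?thesis .
    qed
    have "(\<Sum>u\<in>?U. A u * (L_op \<alpha> N g (u / z) - L_op \<alpha> N g z))
        = (\<Sum>u\<in>?U. A u * (u / z * deriv g (u / z))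
            + A u * (\<Sum>x\<in>?U. ?c * (u / (x * w - u)) * g (x * z))
            + (of_nat N * ?c + \<sigma>) * (A u * g (u / z)) - A u * L_op \<alpha> N g z)"
      by (rule sum.cong) (simp_all only: Lr right_diff_distrib distrib_left mult.left_commute)
    also have "\<dots> = Y + e * g z + (of_nat N * ?c + \<sigma>) * X - \<sigma> * L_op \<alpha> N g z"
      by (simp only: sum.distrib sum_subtractf Y_def X_def cross \<sigma>_def
          sum_distrib_left[symmetric] sum_distrib_right[symmetric])
    finally have "L_op \<alpha> N (L_op \<alpha> N g) z = z * deriv (L_op \<alpha> N g) z
        + (Y + e * g z + (of_nat N * ?c + \<sigma>) * X - \<sigma> * L_op \<alpha> N g z)"
      by (simp only: L_op_eq[OF N, of \<alpha> "L_op \<alpha> N g"] A_def w_def)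
    then show ?thesis
      unfolding H_op_def dL L by (simp add: algebra_simps power2_eq_square)
  qed
  have "L_op \<alpha> N (\<lambda>_. 1) = (\<lambda>_. 0)" by (rule ext) (simp add: L_op_def R_op_def)
  then have "H_op \<alpha> N (\<lambda>_. 1) z = 0"
    by (simp add: H_op_def) (simp add: L_op_def R_op_def)
  then have E: "e + \<sigma>\<^sup>2 + of_nat N * ?c * \<sigma> = 0"
    using key[of "\<lambda>_. 1"] by simp
  have "w ^ N - 1 \<noteq> 0" "1 - w ^ N \<noteq> 0" using w0 by auto
  then have C: "C_coef \<alpha> N z = z * (1 - 2 * \<sigma> - of_nat N * ?c)"
    unfolding C_coef_def \<sigma> power_mult w_def[symmetric]
    by (simp add: divide_simps) algebra
  show ?thesis
    unfolding key[OF f] E C B_def w_def by simp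
qed

section \<open>Inversion symmetry of H\<close>

text \<open>The second-order form is invariant under \<open>z \<mapsto> 1 / z\<close>: the coefficients satisfy
  \<open>C (1 / z) = (2 - C z / z) / z\<close> and \<open>B\<^sub>u (1 / z) = B\<^sub>v z\<close> with \<open>v = 1 / u\<close>.\<close>

lemma H_op_inversion:
  assumes N: "N \<ge> 1" and f: "f holomorphic_on -{0}" and z: "z \<in> regular_points N"
  shows "H_op \<alpha> N (\<lambda>w. f (1 / w)) z = H_op \<alpha> N f (1 / z)"
proof -
  let ?c = "coupling \<alpha>" and ?U = "unity_roots N"
  define g where "g = (\<lambda>w. f (1 / w))"
  define W where "W = z ^ (2 * N)"
  have z0: "z \<noteq> 0" and W: "W \<noteq> 1" "W \<noteq> 0" using z by (auto simp: regular_points_def W_def)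
  have iz: "1 / z \<in> regular_points N"
    using regular_points_rotate_reflect[OF z, of 1] by (simp add: unity_roots_def)
  have f': "deriv f holomorphic_on -{0}" using f by (intro holomorphic_deriv) auto
  have inv: "((\<lambda>w. h (1 / w)) has_field_derivative - deriv h (1 / w) / w\<^sup>2) (at w)"
    if "h holomorphic_on -{0}" "w \<noteq> 0" for h and w :: complex
  proof -
    have "((\<lambda>w. 1 / w) has_field_derivative - (1 / w\<^sup>2)) (at w)"
      using that by (auto intro!: derivative_eq_intros simp: power2_eq_square)
    from DERIV_chain2[OF has_field_derivative_punctured[OF that(1)] this] that show ?thesis by simp
  qed
  have g: "g holomorphic_on -{0}"
    unfolding g_def holomorphic_on_open[OF open_Compl[OF closed_singleton]]
    using inv[OF f] by blast
  have g1: "deriv g w = - deriv f (1 / w) / w\<^sup>2" if "w \<noteq> 0" for w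
    unfolding g_def using inv[OF f that] by (rule DERIV_imp_deriv)
  have "((\<lambda>w. - deriv f (1 / w) / w\<^sup>2) has_field_derivative
      deriv (deriv f) (1 / z) / z ^ 4 + 2 * deriv f (1 / z) / z ^ 3) (at z)"
    using z0 by (auto intro!: derivative_eq_intros inv[OF f'])
      (simp add: field_simps power2_eq_square power3_eq_cube power4_eq_xxxx)
  then have "(deriv g has_field_derivative
      deriv (deriv f) (1 / z) / z ^ 4 + 2 * deriv f (1 / z) / z ^ 3) (at z)"
    by (rule has_field_derivative_transform_within_open[of _ _ _ "-{0}"]) (use z0 g1 in auto)
  then have g2: "deriv (deriv g) z = deriv (deriv f) (1 / z) / z ^ 4 + 2 * deriv f (1 / z) / z ^ 3"
    by (rule DERIV_imp_deriv)
  define m where "m = of_nat N * ?c"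
  define t where "t = 1 / (W - 1)"
  have "1 / (1 / W - 1) = - 1 - t" using W by (simp add: t_def divide_simps algebra_simps)
  then have "2 * m / (1 / W - 1) = 2 * m * (- 1 - t)"
    by (metis mult.right_neutral times_divide_eq_right)
  moreover have "C_coef \<alpha> N (1 / z) = 1 / z * (1 + m + 2 * m / (1 / W - 1))"
    by (simp add: C_coef_def W_def m_def power_divide mult.assoc)
  ultimately have "C_coef \<alpha> N (1 / z) = 1 / z * (1 + m + 2 * m * (- 1 - t))" by simp
  also have "1 + m + 2 * m * (- 1 - t) = 2 - (1 + m + 2 * m * t)" by (simp add: algebra_simps)
  also have "1 + m + 2 * m * t = C_coef \<alpha> N z / z"
    using z0 by (simp add: C_coef_def W_def m_def t_def)
  also have "1 / z * (2 - C_coef \<alpha> N z / z) = (2 - C_coef \<alpha> N z / z) / z" by simp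
  finally have C: "C_coef \<alpha> N (1 / z) = (2 - C_coef \<alpha> N z / z) / z" .
  have "(\<Sum>u\<in>?U. 2 * ?c * u * z\<^sup>2 / (u - z\<^sup>2)\<^sup>2 * (g (u / z) - g z))
      = (\<Sum>u\<in>?U. 2 * ?c * (1 / u) * (1 / z)\<^sup>2 / (1 / u - (1 / z)\<^sup>2)\<^sup>2 * (f (1 / u / (1 / z)) - f (1 / z)))"
  proof (rule sum.cong)
    fix u assume u: "u \<in> ?U"
    define t where "t = u - z\<^sup>2"
    have u0: "u \<noteq> 0" "t \<noteq> 0"
      using unity_roots_nonzero[OF N u] regular_points_unity_roots[OF z u] by (auto simp: t_def)
    have "1 / u - (1 / z)\<^sup>2 = - (t / (u * z\<^sup>2))"
      using u0 z0 by (simp add: t_def field_simps power2_eq_square)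
    then have "2 * ?c * (1 / u) * (1 / z)\<^sup>2 / (1 / u - (1 / z)\<^sup>2)\<^sup>2 = 2 * ?c * u * z\<^sup>2 / t\<^sup>2"
      using u0 z0 by (simp add: power_divide power_mult_distrib) (simp add: field_simps power2_eq_square power4_eq_xxxx)
    then show "2 * ?c * u * z\<^sup>2 / (u - z\<^sup>2)\<^sup>2 * (g (u / z) - g z)
        = 2 * ?c * (1 / u) * (1 / z)\<^sup>2 / (1 / u - (1 / z)\<^sup>2)\<^sup>2 * (f (1 / u / (1 / z)) - f (1 / z))"
      using u0 z0 by (simp add: g_def t_def)
  qed simp
  also have "\<dots> = (\<Sum>u\<in>?U. 2 * ?c * u * (1 / z)\<^sup>2 / (u - (1 / z)\<^sup>2)\<^sup>2 * (f (u / (1 / z)) - f (1 / z)))"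
    by (rule sum_unity_roots_inverse[OF N])
  finally have S: "(\<Sum>u\<in>?U. 2 * ?c * u * z\<^sup>2 / (u - z\<^sup>2)\<^sup>2 * (g (u / z) - g z))
      = (\<Sum>u\<in>?U. 2 * ?c * u * (1 / z)\<^sup>2 / (u - (1 / z)\<^sup>2)\<^sup>2 * (f (u / (1 / z)) - f (1 / z)))" .
  have "z\<^sup>2 * deriv (deriv g) z + C_coef \<alpha> N z * deriv g z
      = (1 / z)\<^sup>2 * deriv (deriv f) (1 / z) + C_coef \<alpha> N (1 / z) * deriv f (1 / z)"
    unfolding g2 g1[OF z0] C using z0
    by (simp add: field_simps power2_eq_square power3_eq_cube power4_eq_xxxx)
  with S show ?thesis
    unfolding H_op_second_order[OF N f iz] H_op_second_order[OF N g z, unfolded g_def]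
    by (simp only: g_def)
qed

section \<open>A differential-reflection equation for the polynomials on the circle\<close>

lemma sieved_a_eq_0:
  assumes "\<not> 2 * N dvd n + 1"
  shows "sieved_a \<alpha> N n = 0"
proof (cases "N dvd n + 1")
  case True
  then obtain k where k: "n + 1 = N * k" by blast
  then have "odd k" using assms by (auto elim!: evenE)
  moreover have "N > 0" "k > 0" using k by (auto intro: Nat.gr0I)
  ultimately show ?thesis unfolding sieved_a_def ultra_a_def k by simp
qed (simp add: sieved_a_def)

lemma sieved_a_even_multiple:
  assumes "2 * N dvd n + 1" "\<alpha> > -1"
  shows "sieved_a \<alpha> N n * (real n + 1 + real N * (2 * \<alpha> + 1)) = - real N * (2 * \<alpha> + 1)"
proof -
  obtain j where j: "n + 1 = N * (2 * j)" using assms(1) by (metis dvdE mult.assoc mult.commute)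
  have "N > 0" "j > 0" using j by (auto intro: Nat.gr0I)
  then have "sieved_a \<alpha> N n = - ((\<alpha> + 1 / 2) * (1 + 1)) / (real (2 * j - 1) + 2 * \<alpha> + 2)"
    unfolding sieved_a_def ultra_a_def j by simp
  also have "(\<alpha> + 1 / 2) * (1 + 1) = 2 * \<alpha> + 1" by simp
  also have "real (2 * j - 1) + 2 * \<alpha> + 2 = 2 * real j + 2 * \<alpha> + 1"
    using \<open>j > 0\<close> by (simp add: of_nat_diff)
  finally have a: "sieved_a \<alpha> N n = - (2 * \<alpha> + 1) / (2 * real j + 2 * \<alpha> + 1)" .
  define d where "d = 2 * real j + 2 * \<alpha> + 1"
  have "d \<noteq> 0" using assms(2) \<open>j > 0\<close> unfolding d_def by linarith
  have "real n + 1 = real N * (2 * real j)" using arg_cong[OF j, of real] by simp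
  then have "real n + 1 + real N * (2 * \<alpha> + 1) = real N * d"
    by (simp add: d_def algebra_simps)
  with a \<open>d \<noteq> 0\<close> show ?thesis unfolding d_def[symmetric] by simp (simp add: algebra_simps)
qed

text \<open>A coefficient of the recurrence can be nonzero only if \<open>N\<close> divides \<open>n + 1\<close>, and then
  \<open>u\<^bsup>n+1\<^esup> = 1\<close>; so both terms of the recurrence pick up the factor \<open>u\<^bsup>n+1\<^esup>\<close>.\<close>

lemma poly_sieved_Phi_rotate:
  assumes "N \<ge> 1" "u \<in> unity_roots N" "z \<noteq> 0"
  shows "poly (sieved_Phi \<alpha> N n) (u * z) = u ^ n * poly (sieved_Phi \<alpha> N n) z"
  using assms(3)
proof (induction n arbitrary: z)
  case 0
  show ?case by simp
next
  case (Suc n)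
  have u0: "u \<noteq> 0" using unity_roots_nonzero assms by blast
  have inv: "1 / u \<in> unity_roots N" using assms(2) by (simp add: unity_roots_def power_divide)
  have refl: "u ^ n * poly (sieved_Phi \<alpha> N n) (1 / (u * z)) = poly (sieved_Phi \<alpha> N n) (1 / z)"
    using Suc.IH[of "1 / (u * z)"] Suc.prems u0 by simp
  have a: "complex_of_real (sieved_a \<alpha> N n) * u ^ Suc n = of_real (sieved_a \<alpha> N n)"
  proof (cases "N dvd n + 1")
    case True
    then obtain d where "n + 1 = N * d" by blast
    then have "u ^ Suc n = (u ^ N) ^ d" by (simp flip: power_mult)
    then show ?thesis using assms(2) by (simp add: unity_roots_def)
  qed (simp add: sieved_a_def)
  have "poly (sieved_Phi \<alpha> N (Suc n)) (u * z) = u ^ Suc n * (z * poly (sieved_Phi \<alpha> N n) z)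
      - of_real (sieved_a \<alpha> N n) * z ^ n * (u ^ n * poly (sieved_Phi \<alpha> N n) (1 / (u * z)))"
    using u0 Suc.prems
    by (simp only: poly_sieved_Phi_Suc no_zero_divisors not_False_eq_True Suc.IH) (simp add: power_mult_distrib mult_ac)
  also have "\<dots> = u ^ Suc n * (z * poly (sieved_Phi \<alpha> N n) z)
      - (of_real (sieved_a \<alpha> N n) * u ^ Suc n) * z ^ n * poly (sieved_Phi \<alpha> N n) (1 / z)"
    by (simp only: refl a)
  also have "\<dots> = u ^ Suc n * poly (sieved_Phi \<alpha> N (Suc n)) z"
    by (simp only: poly_sieved_Phi_Suc[OF Suc.prems] right_diff_distrib mult_ac)
  finally show ?case .
qed

lemma poly_pderiv_sieved_Phi_Suc:
  fixes N n :: nat and \<alpha> :: real and z :: complex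
  assumes "z \<noteq> 0"
  defines "P \<equiv> sieved_Phi \<alpha> N n"
  shows "z * poly (pderiv (sieved_Phi \<alpha> N (Suc n))) z = z * poly P z + z\<^sup>2 * poly (pderiv P) z
    - of_real (sieved_a \<alpha> N n) * z ^ n * (of_nat n * poly P (1 / z) - poly (pderiv P) (1 / z) / z)"
proof -
  let ?a = "complex_of_real (sieved_a \<alpha> N n)"
  have "((\<lambda>z. 1 / z) has_field_derivative - (1 / z\<^sup>2)) (at z)"
    using assms by (auto intro!: derivative_eq_intros simp: power2_eq_square)
  from DERIV_chain2[OF poly_DERIV this]
  have refl: "((\<lambda>z. poly P (1 / z)) has_field_derivative poly (pderiv P) (1 / z) * - (1 / z\<^sup>2)) (at z)" .
  have "((\<lambda>z. z * poly P z - ?a * z ^ n * poly P (1 / z)) has_field_derivative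
     (1 * poly P z + poly (pderiv P) z * z) -
     ((?a * (of_nat n * (1 * z ^ (n - Suc 0)))) * poly P (1 / z) + (poly (pderiv P) (1 / z) * - (1 / z\<^sup>2)) * (?a * z ^ n))) (at z)"
    by (intro DERIV_diff DERIV_mult DERIV_ident poly_DERIV refl DERIV_cmult DERIV_power)
  then have "(poly (sieved_Phi \<alpha> N (Suc n)) has_field_derivative
     (1 * poly P z + poly (pderiv P) z * z) -
     ((?a * (of_nat n * (1 * z ^ (n - Suc 0)))) * poly P (1 / z) + (poly (pderiv P) (1 / z) * - (1 / z\<^sup>2)) * (?a * z ^ n))) (at z)"
    by (rule has_field_derivative_transform_within_open[of _ _ _ "-{0}"])
       (use assms(1) in \<open>auto simp: poly_sieved_Phi_Suc P_def simp del: sieved_Phi.simps\<close>)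
  then have D: "poly (pderiv (sieved_Phi \<alpha> N (Suc n))) z =
     (1 * poly P z + poly (pderiv P) z * z) -
     ((?a * (of_nat n * (1 * z ^ (n - Suc 0)))) * poly P (1 / z) + (poly (pderiv P) (1 / z) * - (1 / z\<^sup>2)) * (?a * z ^ n))"
    by (rule DERIV_unique[OF poly_DERIV])
  have "z * (of_nat n * (1 * z ^ (n - Suc 0))) = of_nat n * z ^ n" by (cases n) auto
  moreover have "z * (1 / z\<^sup>2) = 1 / z" using assms(1) by (simp add: power2_eq_square)
  moreover have "z * ((1 * p + p' * z) - ((a * e) * b + (b' * - q) * (a * zn)))
      = z * p + z\<^sup>2 * p' - a * zn * (m * b - b' * i)"
    if "z * e = m * zn" "z * q = i" for p p' a e b b' q zn m i :: complex
    using that by algebra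
  ultimately show ?thesis unfolding D by (simp only: divide_inverse mult_1)
qed

text \<open>Induction along the recurrence. Where the coefficient vanishes, \<open>\<Phi>\<^sub>n\<^sub>+\<^sub>1 = z \<Phi>\<^sub>n\<close> and the equation is
  multiplied by \<open>z\<close>. Where \<open>2 N\<close> divides \<open>n + 1\<close>, the derivative of the reflected polynomial enters,
  and the induction hypothesis at \<open>1 / z\<close> supplies it; the resulting identity reduces to the
  value of the coefficient in \<open>sieved_a_even_multiple\<close>.\<close>

theorem sieved_Phi_differential_reflection:
  fixes N n :: nat and \<alpha> :: real and z :: complex
  assumes N: "N \<ge> 1" and \<alpha>: "\<alpha> > -1" and "z \<noteq> 0"
  defines "P \<equiv> sieved_Phi \<alpha> N"
  shows "(1 - z ^ (2 * N)) * (z * poly (pderiv (P n)) z - of_nat n * poly (P n) z)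
    = of_nat N * coupling \<alpha> * (poly (P n) z - z ^ (n mod (2 * N)) * z ^ n * poly (P n) (1 / z))"
  using \<open>z \<noteq> 0\<close>
proof (induction n arbitrary: z)
  case 0
  show ?case by (simp add: P_def)
next
  case (Suc n)
  note z0 = Suc.prems
  define W where "W = z ^ (2 * N)"
  define p where "p = poly (P n) z"
  define p' where "p' = poly (pderiv (P n)) z"
  define b where "b = poly (P n) (1 / z)"
  define b' where "b' = poly (pderiv (P n)) (1 / z)"
  define a where "a = complex_of_real (sieved_a \<alpha> N n)"
  have IH: "(1 - W) * (z * p' - of_nat n * p)
      = of_nat N * coupling \<alpha> * (p - z ^ (n mod (2 * N)) * z ^ n * b)"
    unfolding W_def p_def p'_def b_def using Suc.IH[OF z0] .
  have P1: "poly (P (Suc n)) z = z * p - a * z ^ n * b"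
    unfolding P_def p_def a_def b_def using poly_sieved_Phi_Suc[OF z0] .
  have P2: "poly (P (Suc n)) (1 / z) = 1 / z * b - a * (1 / z) ^ n * p"
    using poly_sieved_Phi_Suc[of "1 / z" \<alpha> N n] z0 by (simp add: P_def p_def a_def b_def)
  have P3: "z * poly (pderiv (P (Suc n))) z
      = z * p + z\<^sup>2 * p' - a * z ^ n * (of_nat n * b - b' / z)"
    unfolding P_def p_def p'_def a_def b_def b'_def using poly_pderiv_sieved_Phi_Suc[OF z0] .
  show ?case
  proof (cases "2 * N dvd n + 1")
    case False
    then have "a = 0" using sieved_a_eq_0 by (simp add: a_def)
    have "Suc n mod (2 * N) = Suc (n mod (2 * N))"
      using False by (simp add: mod_Suc) (metis Suc_eq_plus1 mod_Suc mod_eq_0_iff_dvd)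
    then have "z ^ (Suc n mod (2 * N)) * z ^ Suc n * (1 / z * b) = z * (z ^ (n mod (2 * N)) * z ^ n * b)"
      using z0 by simp
    moreover have "(1 - W) * (z * p + z\<^sup>2 * p' - of_nat (Suc n) * (z * p))
        = z * ((1 - W) * (z * p' - of_nat n * p))"
      by (simp add: algebra_simps power2_eq_square)
    ultimately show ?thesis
      unfolding P1 P2 P3 W_def[symmetric] \<open>a = 0\<close> mult_zero_left diff_0_right
      by (simp only: IH) (simp only: right_diff_distrib mult.left_commute[of z])
  next
    case True
    have r0: "Suc n mod (2 * N) = 0" using True by simp
    then have "Suc (n mod (2 * N)) = 2 * N" using N
      by (metis mod_Suc nat.distinct(1))
    then have Wr: "z ^ (n mod (2 * N)) * z = W" unfolding W_def by (metis power_Suc2)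
    have W0: "W \<noteq> 0" using z0 by (simp add: W_def)
    \<comment> \<open>\<open>X\<close> is the reflected polynomial, and \<open>n X - Y\<close> is \<open>z\<close> times its derivative.\<close>
    define X where "X = z ^ n * b"
    define Y where "Y = z ^ n * b' / z"
    have e1: "(1 - W) * (z * (z * p' - of_nat n * p)) = of_nat N * coupling \<alpha> * (z * p - W * X)"
    proof -
      have "V * (z * (z * p' - of_nat n * p)) = K * (z * p - W * (z ^ n * b))"
        if "V * (z * p' - of_nat n * p) = K * (p - y * z ^ n * b)" "y * z = W" for V K y
        using arg_cong[OF that(1), of "(*) z"] unfolding that(2)[symmetric]
        by (simp add: algebra_simps)
      from this[OF IH Wr] show ?thesis by (simp only: X_def)
    qed
    have e2: "(W - 1) * (Y - of_nat n * X) = of_nat N * coupling \<alpha> * (W * X - z * p)"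
    proof -
      have "(1 - (1 / z) ^ (2 * N)) * (1 / z * b' - of_nat n * b)
          = of_nat N * coupling \<alpha> * (b - (1 / z) ^ (n mod (2 * N)) * (1 / z) ^ n * p)"
        using Suc.IH[of "1 / z"] z0 by (simp add: p_def b_def b'_def)
      then have "(W * z ^ n) * ((1 - 1 / W) * (1 / z * b' - of_nat n * b))
          = (W * z ^ n) * (of_nat N * coupling \<alpha> * (b - 1 / z ^ (n mod (2 * N)) * (1 / z ^ n) * p))"
        by (simp add: W_def power_one_over)
      moreover have "W * (1 / z ^ (n mod (2 * N))) = z" using Wr z0 by (simp add: field_simps)
      moreover have "z ^ n * (1 / z ^ n) = 1" "W * (1 / W) = 1" using z0 W0 by auto
      moreover have "Y = z ^ n * b' * (1 / z)" by (simp add: Y_def)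
      moreover have "(W - 1) * (Y - m * (zn * b)) = K * (W * (zn * b) - z * p)"
        if "(W * zn) * ((1 - iW) * (iz * b' - m * b)) = (W * zn) * (K * (b - r * izn * p))"
          "W * r = z" "zn * izn = 1" "W * iW = 1" "Y = zn * b' * iz" for zn iW iz m K r izn
        using that by algebra
      ultimately show ?thesis unfolding X_def by blast
    qed
    have e3: "a * (of_nat n + 1 + of_nat N * coupling \<alpha>) = - (of_nat N * coupling \<alpha>)"
      using arg_cong[OF sieved_a_even_multiple[OF True \<alpha>], of complex_of_real] by (simp add: a_def)
    have combine: "(1 - W) * (z * p + z\<^sup>2 * p' - a * (m * X - Y) - (1 + m) * (z * p - a * X))
        = K * (z * p - a * X - (X - a * z * p))"
      if "(1 - W) * (z * (z * p' - m * p)) = K * (z * p - W * X)"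
        "(W - 1) * (Y - m * X) = K * (W * X - z * p)" "a * (m + 1 + K) = - K" for m K
      using that by algebra
    have "a * z ^ n * (of_nat n * b - b' / z) = a * (of_nat n * X - Y)"
      by (simp add: X_def Y_def algebra_simps)
    moreover have "a * z ^ n * b = a * X" by (simp add: X_def)
    moreover have "z ^ Suc n * (1 / z * b - a * (1 / z) ^ n * p) = X - a * z * p"
      using z0 by (simp add: X_def field_simps)
    ultimately show ?thesis
      unfolding P1 P2 P3 W_def[symmetric] r0 power_0 mult_1 of_nat_Suc
      using combine[OF e1 e2 e3] by (simp only:)
  qed
qed

section \<open>Eigenfunctions of L and H\<close>

text \<open>The odd-index members of the Cantero-Moral-Velazquez basis of Laurent polynomials; the exponents
  of \<open>z\<close> lie between \<open>- n\<close> and \<open>n + 1\<close>.\<close>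

definition cmv_function :: "real \<Rightarrow> nat \<Rightarrow> nat \<Rightarrow> complex \<Rightarrow> complex" where
  "cmv_function \<alpha> N n z = poly (sieved_Phi \<alpha> N (2 * n + 1)) z / z ^ n"

lemma holomorphic_cmv_function: "cmv_function \<alpha> N n holomorphic_on -{0}"
  unfolding cmv_function_def[abs_def] by (intro holomorphic_intros) auto

text \<open>By the rotation rule the reflected value at \<open>u / z\<close> is \<open>u\<^bsup>n+1\<^esup>\<close> times \<open>z\<^sup>n \<Phi>\<^sub>2\<^sub>n\<^sub>+\<^sub>1(1/z)\<close>, so the
  sum over \<open>u\<close> in \<open>L\<close> is given by \<open>sum_unity_roots_resolvent\<close>, and the claim becomes the
  differential-reflection equation with index \<open>2 n + 1\<close>.\<close>

theorem L_op_cmv_function: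
  assumes N: "N \<ge> 1" and \<alpha>: "\<alpha> > -1" and z: "z \<in> regular_points N"
  shows "L_op \<alpha> N (cmv_function \<alpha> N n) z
    = (of_nat n + 1 + of_nat N * coupling \<alpha>) * cmv_function \<alpha> N n z"
proof -
  let ?c = "coupling \<alpha>" and ?U = "unity_roots N"
  define P where "P = sieved_Phi \<alpha> N (2 * n + 1)"
  define p where "p = poly P z"
  define p' where "p' = poly (pderiv P) z"
  define b where "b = poly P (1 / z)"
  define W where "W = z ^ (2 * N)"
  \<comment> \<open>The representative of \<open>n + 1\<close> modulo \<open>N\<close> in the range \<open>1..N\<close> that the resolvent sum requires;
    it satisfies \<open>2 s = (2 n + 1) mod (2 N) + 1\<close>.\<close>
  define s where "s = n mod N + 1"
  have z0: "z \<noteq> 0" and W: "1 - W \<noteq> 0" using z by (auto simp: regular_points_def W_def)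
  have w: "(z\<^sup>2) ^ N = W" by (simp add: W_def flip: power_mult)
  have s: "1 \<le> s" "s \<le> N" using N by (auto simp: s_def Suc_le_eq)
  have psi: "cmv_function \<alpha> N n z = p / z ^ n" by (simp add: cmv_function_def p_def P_def)
  have "(cmv_function \<alpha> N n has_field_derivative
      (p' * z ^ n - p * (of_nat n * z ^ (n - 1))) / (z ^ n * z ^ n)) (at z)"
    unfolding cmv_function_def[abs_def] p_def p'_def P_def
    by (rule derivative_eq_intros poly_DERIV refl)+ (use z0 in auto)
  then have "deriv (cmv_function \<alpha> N n) z = (p' * z ^ n - p * (of_nat n * z ^ (n - 1))) / (z ^ n * z ^ n)"
    by (rule DERIV_imp_deriv)
  moreover have "z * (p' * z ^ n - p * (of_nat n * z ^ (n - 1))) = z ^ n * (z * p' - of_nat n * p)"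
  proof -
    have "z * (of_nat n * z ^ (n - 1)) = of_nat n * z ^ n" by (cases n) auto
    then show ?thesis by (simp only: right_diff_distrib mult_ac)
  qed
  ultimately have d: "z * deriv (cmv_function \<alpha> N n) z = (z * p' - of_nat n * p) / z ^ n"
    using z0 by (simp only: times_divide_eq_right) simp
  have refl: "cmv_function \<alpha> N n (u / z) = u ^ s * (z ^ n * b)" if u: "u \<in> ?U" for u
  proof -
    have u0: "u \<noteq> 0" using unity_roots_nonzero[OF N u] .
    have "cmv_function \<alpha> N n (u / z) = u ^ (2 * n + 1) * b / (u / z) ^ n"
      using poly_sieved_Phi_rotate[OF N u, of "1 / z" \<alpha> "2 * n + 1"] z0
      by (simp add: cmv_function_def b_def P_def)
    also have "\<dots> = u ^ (n + 1) * (z ^ n * b)"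
      using u0 z0 by (simp add: power_divide power_add mult_2)
    also have "n + 1 = N * (n div N) + s" by (simp add: s_def)
    also have "u ^ \<dots> = u ^ s" using u by (simp add: power_add power_mult unity_roots_def)
    finally show ?thesis .
  qed
  have "(\<Sum>u\<in>?U. ?c * z\<^sup>2 / (u - z\<^sup>2) * (cmv_function \<alpha> N n (u / z) - cmv_function \<alpha> N n z))
      = (\<Sum>u\<in>?U. (?c * z\<^sup>2 * (z ^ n * b)) * (u ^ s / (u - z\<^sup>2)) - (?c * (p / z ^ n)) * (z\<^sup>2 / (u - z\<^sup>2)))"
    by (rule sum.cong) (simp_all add: refl psi right_diff_distrib diff_divide_distrib mult_ac)
  also have "\<dots> = (?c * z\<^sup>2 * (z ^ n * b)) * (of_nat N * (z\<^sup>2) ^ (s - 1) / (1 - W))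
      - (?c * (p / z ^ n)) * (of_nat N * W / (1 - W))"
    using sum_unity_roots_resolvent[OF N s, of "z\<^sup>2"] sum_unity_roots_resolvent_weighted[OF N, of "z\<^sup>2"] W
    by (simp only: sum_subtractf sum_distrib_left[symmetric] w) simp
  also have "\<dots> = (of_nat N * ?c * ((z\<^sup>2 * (z\<^sup>2) ^ (s - 1)) * (z ^ n * z ^ n) * b - W * p)) / ((1 - W) * z ^ n)"
    using W z0 by (simp add: divide_simps) (simp add: algebra_simps)
  also have "z\<^sup>2 * (z\<^sup>2) ^ (s - 1) = z ^ (2 * s)"
    using s by (simp add: power_mult flip: power_Suc)
  also have "z ^ (2 * s) * (z ^ n * z ^ n) = z ^ ((2 * n + 1) mod (2 * N)) * z ^ (2 * n + 1)"
  proof -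
    have "(2 * n + 1) mod (2 * N) = 2 * (n mod N) + 1"
      using mod_mult2_eq[of "2 * n + 1" 2 N] by simp
    then show ?thesis by (simp add: s_def power_add mult_2)
  qed
  finally have S: "(\<Sum>u\<in>?U. ?c * z\<^sup>2 / (u - z\<^sup>2) * (cmv_function \<alpha> N n (u / z) - cmv_function \<alpha> N n z))
      = of_nat N * ?c * (z ^ ((2 * n + 1) mod (2 * N)) * z ^ (2 * n + 1) * b - W * p) / ((1 - W) * z ^ n)" .
  have "(1 - W) * (z * p' - of_nat (2 * n + 1) * p)
      = of_nat N * ?c * (p - z ^ ((2 * n + 1) mod (2 * N)) * z ^ (2 * n + 1) * b)"
    unfolding W_def p_def p'_def b_def P_def
    by (rule sieved_Phi_differential_reflection[OF N \<alpha> z0])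
  moreover have "(1 - W) * (z * p' - m * p) + K * (Z * b - W * p) = (1 - W) * ((m + 1 + K) * p)"
    if "(1 - W) * (z * p' - (2 * m + 1) * p) = K * (p - Z * b)" for m K Z
    using that by algebra
  ultimately have "(1 - W) * (z * p' - of_nat n * p)
      + of_nat N * ?c * (z ^ ((2 * n + 1) mod (2 * N)) * z ^ (2 * n + 1) * b - W * p)
      = (1 - W) * ((of_nat n + 1 + of_nat N * ?c) * p)"
    by (simp only: of_nat_add of_nat_mult of_nat_numeral of_nat_1)
  then have "(z * p' - of_nat n * p) / z ^ n
      + of_nat N * ?c * (z ^ ((2 * n + 1) mod (2 * N)) * z ^ (2 * n + 1) * b - W * p) / ((1 - W) * z ^ n)
      = (of_nat n + 1 + of_nat N * ?c) * (p / z ^ n)"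
    using W z0 by (simp add: divide_simps) (simp add: mult_ac)
  then show ?thesis
    by (simp only: L_op_eq[OF N] d S) (simp only: psi)
qed

theorem H_op_cmv_function:
  assumes N: "N \<ge> 1" and \<alpha>: "\<alpha> > -1" and z: "z \<in> regular_points N"
  shows "H_op \<alpha> N (cmv_function \<alpha> N n) z
    = (of_nat n + 1) * (of_nat n + 1 + of_nat N * coupling \<alpha>) * cmv_function \<alpha> N n z"
proof -
  let ?\<psi> = "cmv_function \<alpha> N n"
  define l where "l = of_nat n + 1 + of_nat N * coupling \<alpha>"
  note L = L_op_cmv_function[OF N \<alpha>, of _ n, folded l_def]
  have "z \<noteq> 0" using z by (simp add: regular_points_def)
  then have "(\<lambda>w. l * ?\<psi> w) field_differentiable at z" "?\<psi> field_differentiable at z"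
    using holomorphic_cmv_function[of \<alpha> N n]
    by (auto intro!: holomorphic_on_imp_differentiable_at[of _ "-{0}"] holomorphic_intros)
  then have "L_op \<alpha> N (\<lambda>w. l * ?\<psi> w) z = l * L_op \<alpha> N ?\<psi> z"
    by (simp add: L_op_eq[OF N] sum_distrib_left algebra_simps)
  moreover have "L_op \<alpha> N (L_op \<alpha> N ?\<psi>) z = L_op \<alpha> N (\<lambda>w. l * ?\<psi> w) z"
    by (rule L_op_cong[OF N z]) (rule L)
  ultimately have "H_op \<alpha> N ?\<psi> z = l * (l * ?\<psi> z) - of_nat N * coupling \<alpha> * (l * ?\<psi> z)"
    by (simp add: H_op_def L[OF z])
  then show ?thesis by (simp add: l_def algebra_simps)
qed

section \<open>Existence and uniqueness of the polynomials Q\<close>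

text \<open>The Chebyshev polynomials of the second kind in the normalization \<open>U\<^sub>k (x / 2)\<close>, which is monic
  and fits the variable \<open>x = z + 1 / z\<close>.\<close>

fun chebyshev_U :: "nat \<Rightarrow> complex poly" where
  "chebyshev_U 0 = 1"
| "chebyshev_U (Suc 0) = [:0, 1:]"
| "chebyshev_U (Suc (Suc k)) = pCons 0 (chebyshev_U (Suc k)) - chebyshev_U k"

lemma degree_chebyshev_U_le: "degree (chebyshev_U k) \<le> k"
proof (induction k rule: chebyshev_U.induct)
  case (3 k)
  then show ?case by (auto intro!: degree_diff_le simp: degree_pCons_le order_trans[OF degree_pCons_le])
qed auto

lemma coeff_chebyshev_U: "coeff (chebyshev_U k) k = 1"
proof (induction k rule: chebyshev_U.induct)
  case (3 k)
  have "coeff (chebyshev_U k) (Suc (Suc k)) = 0"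
    using degree_chebyshev_U_le[of k] by (intro coeff_eq_0) simp
  with 3 show ?case by simp
qed auto

lemma poly_chebyshev_U:
  assumes "z \<noteq> 0"
  shows "(z - 1 / z) * poly (chebyshev_U k) (z + 1 / z) = z ^ (k + 1) - 1 / z ^ (k + 1)"
proof (induction k rule: chebyshev_U.induct)
  case 1
  show ?case by simp
next
  case 2
  show ?case by (simp add: algebra_simps power2_eq_square)
next
  case (3 k)
  have "(z - 1 / z) * poly (chebyshev_U (Suc (Suc k))) (z + 1 / z)
      = (z + 1 / z) * (z ^ (Suc k + 1) - 1 / z ^ (Suc k + 1)) - (z ^ (k + 1) - 1 / z ^ (k + 1))"
    unfolding 3[symmetric] by (simp add: right_diff_distrib mult.left_commute)
  also have "\<dots> = z ^ (Suc (Suc k) + 1) - 1 / z ^ (Suc (Suc k) + 1)"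
    using assms by (simp add: field_simps)
  finally show ?case .
qed

text \<open>The map \<open>z \<mapsto> z + 1 / z\<close> takes all complex values, and the excluded points \<open>z\<^sup>2 = 1\<close> account only
  for the two values 2 and -2.\<close>

lemma poly_eqI_joukowski:
  fixes P Q :: "complex poly"
  assumes "\<And>z. z \<noteq> 0 \<Longrightarrow> z\<^sup>2 \<noteq> 1 \<Longrightarrow> poly P (z + 1 / z) = poly Q (z + 1 / z)"
  shows "P = Q"
proof -
  have "poly P x = poly Q x" if x: "x \<noteq> 2" "x \<noteq> -2" for x
  proof -
    define z where "z = (x + csqrt (x\<^sup>2 - 4)) / 2"
    have "2 * z - x = csqrt (x\<^sup>2 - 4)"
      by (simp add: z_def del: distrib_left_numeral)
    then have "(2 * z - x)\<^sup>2 = x\<^sup>2 - 4" by simp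
    then have "4 * (z * z + 1) = 4 * (x * z)" by (simp add: algebra_simps power2_eq_square)
    then have q: "z * z + 1 = x * z" by (simp only: mult_cancel_left) simp
    then have z0: "z \<noteq> 0" by auto
    then have xz: "z + 1 / z = x" using q by (simp add: field_simps)
    have "z\<^sup>2 \<noteq> 1" using xz x by (auto simp: power2_eq_1_iff)
    from assms[OF z0 this] show ?thesis by (simp add: xz)
  qed
  then have "{x. poly (P - Q) x = 0} \<supseteq> UNIV - {2, -2}" by auto
  moreover have "infinite (UNIV - {2, -2 :: complex})"
    by (intro Diff_infinite_finite) (auto simp: infinite_UNIV_char_0)
  ultimately have "infinite {x. poly (P - Q) x = 0}" using finite_subset by blast
  then have "P - Q = 0" using poly_roots_finite by blast
  then show ?thesis by simp
qed

text \<open>The monomial \<open>z\<^sup>j\<close> of \<open>P\<close> contributes \<open>z\<^bsup>j-n\<^esup> - z\<^bsup>n-j\<^esup>\<close> to the right-hand side, which is \<open>z - 1 / z\<close>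
  times zero for \<open>j = n\<close> and otherwise times a Chebyshev polynomial, up to sign, of degree
  \<open>\<bar>j - n\<bar> - 1\<close> (\<open>V j\<close> in the proof). Only the leading monomial \<open>j = 2 n + 1\<close> reaches degree \<open>n\<close>.\<close>

lemma joukowski_quotient_exists:
  fixes P :: "complex poly"
  assumes P: "degree P = 2 * n + 1" "lead_coeff P = 1"
  shows "\<exists>Q. degree Q = n \<and> lead_coeff Q = 1 \<and> (\<forall>z. z \<noteq> 0 \<longrightarrow>
    (z - 1 / z) * poly Q (z + 1 / z) = poly P z / z ^ n - z ^ n * poly P (1 / z))"
proof -
  define V where "V j = (if n < j then chebyshev_U (j - n - 1)
    else if j < n then - chebyshev_U (n - j - 1) else 0)" for j
  define R where "R = (\<Sum>j\<le>2 * n. smult (coeff P j) (V j))"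
  define Q where "Q = chebyshev_U n + R"
  have V: "(z - 1 / z) * poly (V j) (z + 1 / z) = z ^ j / z ^ n - z ^ n / z ^ j" if "z \<noteq> 0" for z j
  proof (cases n j rule: linorder_cases)
    case less
    then obtain i where j: "j = n + (i + 1)" using less_imp_Suc_add by auto
    have "(z - 1 / z) * poly (V j) (z + 1 / z) = z ^ (i + 1) - 1 / z ^ (i + 1)"
      using poly_chebyshev_U[OF that, of i] by (simp add: V_def j)
    then show ?thesis using that by (simp only: j power_add[of z n]) simp
  next
    case greater
    then obtain i where n: "n = j + (i + 1)" using less_imp_Suc_add by auto
    have "(z - 1 / z) * poly (V j) (z + 1 / z) = 1 / z ^ (i + 1) - z ^ (i + 1)"
      using poly_chebyshev_U[OF that, of i] by (simp add: V_def n)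
    then show ?thesis using that by (simp only: n power_add[of z j]) simp
  qed (use that in \<open>simp add: V_def\<close>)
  have coR: "coeff R i = 0" if "i \<ge> n" for i
  proof -
    have "coeff (V j) i = 0" if "j \<le> 2 * n" for j
    proof -
      have "degree (chebyshev_U (j - n - 1)) < i" if "n < j"
        using degree_chebyshev_U_le[of "j - n - 1"] that \<open>j \<le> 2 * n\<close> \<open>i \<ge> n\<close> by linarith
      moreover have "degree (chebyshev_U (n - j - 1)) < i" if "j < n"
        using degree_chebyshev_U_le[of "n - j - 1"] that \<open>i \<ge> n\<close> by linarith
      ultimately show ?thesis by (auto simp: V_def coeff_eq_0)
    qed
    then show ?thesis by (simp add: R_def coeff_sum)
  qed
  have co: "coeff Q i = coeff (chebyshev_U n) i" if "i \<ge> n" for i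
    using coR[OF that] by (simp add: Q_def)
  have "degree Q \<le> n"
  proof (rule degree_le, intro allI impI)
    fix i assume "n < i"
    then have "coeff (chebyshev_U n) i = 0"
      using degree_chebyshev_U_le[of n] by (intro coeff_eq_0) simp
    then show "coeff Q i = 0" using co[of i] \<open>n < i\<close> by simp
  qed
  moreover have "coeff Q n = 1" using co[of n] by (simp add: coeff_chebyshev_U)
  ultimately have "degree Q = n" using le_degree[of Q n] by (metis le_antisym one_neq_zero)
  moreover have "(z - 1 / z) * poly Q (z + 1 / z) = poly P z / z ^ n - z ^ n * poly P (1 / z)"
    if z: "z \<noteq> 0" for z
  proof -
    have VQ: "V (2 * n + 1) = chebyshev_U n" by (simp add: V_def)
    have "coeff P (2 * n + 1) = 1" using P by simp
    then have "Q = (\<Sum>j\<le>2 * n + 1. smult (coeff P j) (V j))" by (simp add: Q_def R_def flip: VQ)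
    then have "(z - 1 / z) * poly Q (z + 1 / z)
        = (\<Sum>j\<le>2 * n + 1. coeff P j * ((z - 1 / z) * poly (V j) (z + 1 / z)))"
      by (simp add: poly_sum sum_distrib_left mult.left_commute del: sum.atMost_Suc)
    also have "\<dots> = (\<Sum>j\<le>2 * n + 1. coeff P j * z ^ j) / z ^ n - z ^ n * (\<Sum>j\<le>2 * n + 1. coeff P j * (1 / z) ^ j)"
      by (simp only: V[OF z] sum_divide_distrib sum_distrib_left sum_subtractf[symmetric])
         (rule sum.cong, simp, simp add: power_divide right_diff_distrib)
    also have "\<dots> = poly P z / z ^ n - z ^ n * poly P (1 / z)"
      by (simp only: poly_altdef P(1))
    finally show ?thesis .
  qed
  ultimately show ?thesis using \<open>coeff Q n = 1\<close> by (intro exI[of _ Q]) simp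
qed

lemma sieved_Q_spec:
  shows degree_sieved_Q: "degree (sieved_Q \<alpha> N n) = n"
    and lead_coeff_sieved_Q: "lead_coeff (sieved_Q \<alpha> N n) = 1"
    and poly_sieved_Q: "z \<noteq> 0 \<Longrightarrow> (z - 1 / z) * poly (sieved_Q \<alpha> N n) (z + 1 / z)
      = cmv_function \<alpha> N n z - cmv_function \<alpha> N n (1 / z)"
proof -
  let ?P = "sieved_Phi \<alpha> N (2 * n + 1)"
  define rhs where "rhs z = (poly ?P z / z ^ n - z ^ n * poly ?P (1 / z)) / (z - 1 / z)" for z
  have deg: "degree ?P = 2 * n + 1" "lead_coeff ?P = 1"
    using sieved_Phi_monic by blast+
  from joukowski_quotient_exists[OF this]
  obtain Q where Q: "degree Q = n" "lead_coeff Q = 1"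
    "\<And>z. z \<noteq> 0 \<Longrightarrow> (z - 1 / z) * poly Q (z + 1 / z) = poly ?P z / z ^ n - z ^ n * poly ?P (1 / z)"
    by blast
  have nz: "z - 1 / z \<noteq> 0" if "z \<noteq> 0" "z\<^sup>2 \<noteq> 1" for z :: complex
    using that by (simp add: field_simps power2_eq_square)
  have Q': "poly Q (z + 1 / z) = rhs z" if "z \<noteq> 0" "z\<^sup>2 \<noteq> 1" for z
    unfolding rhs_def Q(3)[OF that(1), symmetric] using nz[OF that] by simp
  have "sieved_Q \<alpha> N n = Q"
    unfolding sieved_Q_def rhs_def[symmetric]
  proof (rule the_equality)
    fix Q2 assume "degree Q2 = n \<and> lead_coeff Q2 = 1 \<and>
      (\<forall>z. z \<noteq> 0 \<and> z\<^sup>2 \<noteq> 1 \<longrightarrow> poly Q2 (z + 1 / z) = rhs z)"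
    then show "Q2 = Q" using Q' by (intro poly_eqI_joukowski) auto
  qed (use Q Q' in auto)
  then show "degree (sieved_Q \<alpha> N n) = n" "lead_coeff (sieved_Q \<alpha> N n) = 1"
    "z \<noteq> 0 \<Longrightarrow> (z - 1 / z) * poly (sieved_Q \<alpha> N n) (z + 1 / z)
      = cmv_function \<alpha> N n z - cmv_function \<alpha> N n (1 / z)"
    using Q by (auto simp: cmv_function_def power_divide simp del: sieved_Phi.simps)
qed

section \<open>The eigenvalue equation\<close>

lemma punctured_plane_derivatives:
  assumes "f holomorphic_on -{0}" "z \<noteq> 0"
  shows "(f has_field_derivative deriv f z) (at z)"
    and "(deriv f has_field_derivative deriv (deriv f) z) (at z)"
proof -
  show "(f has_field_derivative deriv f z) (at z)"
    using assms by (rule has_field_derivative_punctured)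
  have "deriv f holomorphic_on -{0}" using assms(1) by (rule holomorphic_deriv) auto
  then show "(deriv f has_field_derivative deriv (deriv f) z) (at z)"
    using assms(2) by (rule has_field_derivative_punctured)
qed

lemma H_op_diff:
  assumes N: "N \<ge> 1" and f: "f holomorphic_on -{0}" and g: "g holomorphic_on -{0}"
    and z: "z \<in> regular_points N"
  shows "H_op \<alpha> N (\<lambda>w. f w - g w) z = H_op \<alpha> N f z - H_op \<alpha> N g z"
proof -
  have z0: "z \<noteq> 0" using z by (simp add: regular_points_def)
  have d: "deriv (\<lambda>w. f w - g w) w = deriv f w - deriv g w" if "w \<noteq> 0" for w
    using that f g by (intro DERIV_imp_deriv DERIV_diff has_field_derivative_punctured)
  have "deriv (deriv (\<lambda>w. f w - g w)) z = deriv (\<lambda>w. deriv f w - deriv g w) z"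
    by (rule deriv_cong_ev[OF _ refl]) (use d z0 in \<open>auto intro: eventually_mono[OF t1_space_nhds]\<close>)
  also have "\<dots> = deriv (deriv f) z - deriv (deriv g) z"
    using z0 f g by (intro DERIV_imp_deriv DERIV_diff has_field_derivative_punctured holomorphic_deriv) auto
  finally have d2: "deriv (deriv (\<lambda>w. f w - g w)) z = deriv (deriv f) z - deriv (deriv g) z" .
  have fg: "(\<lambda>w. f w - g w) holomorphic_on -{0}" by (intro holomorphic_intros f g)
  show ?thesis
    unfolding H_op_second_order[OF N fg z] H_op_second_order[OF N f z] H_op_second_order[OF N g z] d2 d[OF z0]
    by (simp only: right_diff_distrib sum_subtractf) (simp only: algebra_simps)
qed

theorem H_hat_sieved_Q:
  assumes N: "N \<ge> 1" and \<alpha>: "\<alpha> > -1" and z: "z \<in> regular_points N"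
  shows "H_hat \<alpha> N (\<lambda>w. poly (sieved_Q \<alpha> N n) (w + 1 / w)) z =
    complex_of_real (real n * (real n + (2 * \<alpha> + 1) * real N + 2)) * poly (sieved_Q \<alpha> N n) (z + 1 / z)"
proof -
  let ?\<psi> = "cmv_function \<alpha> N n" and ?c = "coupling \<alpha>"
  let ?q = "\<lambda>w. poly (sieved_Q \<alpha> N n) (w + 1 / w)"
  define l where "l = (of_nat n + 1) * (of_nat n + 1 + of_nat N * ?c)"
  have z0: "z \<noteq> 0" using z by (simp add: regular_points_def)
  have zz: "z - 1 / z \<noteq> 0"
  proof
    assume "z - 1 / z = 0"
    then have "z\<^sup>2 = 1" using z0 by (simp add: field_simps power2_eq_square)
    then have "z ^ (2 * N) = 1" by (simp add: power_mult)
    then show False using z by (simp add: regular_points_def)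
  qed
  have iz: "1 / z \<in> regular_points N"
    using regular_points_rotate_reflect[OF z, of 1] by (simp add: unity_roots_def)
  have inv: "(\<lambda>w. ?\<psi> (1 / w)) holomorphic_on -{0}"
  proof -
    have "(\<lambda>w::complex. 1 / w) holomorphic_on -{0}" by (intro holomorphic_intros) auto
    moreover have "(\<lambda>w::complex. 1 / w) ` (-{0}) \<subseteq> -{0}" by auto
    ultimately show ?thesis
      using holomorphic_on_compose_gen[OF _ holomorphic_cmv_function[of \<alpha> N n]] by (simp only: o_def)
  qed
  have "H_op \<alpha> N (\<lambda>w. (w - 1 / w) * ?q w) z = H_op \<alpha> N (\<lambda>w. ?\<psi> w - ?\<psi> (1 / w)) z"
    by (rule H_op_cong[OF N z]) (simp add: poly_sieved_Q regular_points_def)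
  also have "\<dots> = l * (?\<psi> z - ?\<psi> (1 / z))"
    unfolding H_op_diff[OF N holomorphic_cmv_function inv z]
      H_op_inversion[OF N holomorphic_cmv_function z]
      H_op_cmv_function[OF N \<alpha> z] H_op_cmv_function[OF N \<alpha> iz] l_def
    by (simp add: right_diff_distrib)
  also have "\<dots> = (z - 1 / z) * (l * ?q z)"
    using poly_sieved_Q[OF z0, of \<alpha> N n] by simp
  finally have "H_hat \<alpha> N ?q z = l * ?q z - of_real (real N * (2 * \<alpha> + 1) + 1) * ?q z"
    unfolding H_hat_def using zz by simp
  also have "l - of_real (real N * (2 * \<alpha> + 1) + 1)
      = complex_of_real (real n * (real n + (2 * \<alpha> + 1) * real N + 2))"
    by (simp add: l_def algebra_simps)
  then have "l * ?q z - of_real (real N * (2 * \<alpha> + 1) + 1) * ?q z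
      = complex_of_real (real n * (real n + (2 * \<alpha> + 1) * real N + 2)) * ?q z"
    by (simp only: left_diff_distrib[symmetric])
  finally show ?thesis .
qed

lemma sieved_Q_0: "sieved_Q \<alpha> N 0 = 1"
proof -
  obtain c where "sieved_Q \<alpha> N 0 = [:c:]" using degree_sieved_Q degree_eq_zeroE by blast
  then show ?thesis using lead_coeff_sieved_Q[of \<alpha> N 0] by (simp add: one_pCons)
qed

section \<open>The explicit forms of the conjugated operator\<close>

lemma laurent_polynomial_holomorphic:
  assumes "laurent_polynomial f"
  shows "f holomorphic_on -{0}"
proof -
  obtain c m where f: "\<And>z. z \<noteq> 0 \<Longrightarrow> f z = (\<Sum>k = - int m..int m. c k * z powi k)"
    using assms unfolding laurent_polynomial_def by blast
  have "(\<lambda>z. \<Sum>k = - int m..int m. c k * z powi k) holomorphic_on -{0}"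
    by (intro holomorphic_intros) auto
  then show ?thesis by (rule holomorphic_transform) (simp add: f)
qed

text \<open>Apply \<open>H_op_second_order\<close> to \<open>(z - 1 / z) f\<close> and divide by \<open>z - 1 / z\<close>. The product rule turns \<open>C\<close>
  into its hatted version, and the reflected factor \<open>u / z - z / u\<close> does the same for the \<open>B\<^sub>u\<close>. The coefficient \<open>e\<close> of
  \<open>f z\<close> is the same for all \<open>f\<close>, so it is read off from \<open>f = 1\<close>, where the left-hand side
  vanishes by the eigenvalue equation for \<open>Q\<^sub>0 = 1\<close>.\<close>

theorem H_hat_second_order:
  assumes N: "N \<ge> 1" and \<alpha>: "\<alpha> > -1" and f: "f holomorphic_on -{0}" and z: "z \<in> regular_points N"
  shows "H_hat \<alpha> N f z = H_hat_R \<alpha> N f z"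
proof -
  let ?c = "coupling \<alpha>" and ?U = "unity_roots N"
  define Bh where "Bh u = (u\<^sup>2 - z\<^sup>2) / (u * (z\<^sup>2 - 1)) * (2 * ?c * u * z\<^sup>2 / (u - z\<^sup>2)\<^sup>2)" for u
  have z0: "z \<noteq> 0" using z by (simp add: regular_points_def)
  have z1: "z\<^sup>2 - 1 \<noteq> 0"
    using z by (auto simp: regular_points_def power_mult)
  have zz: "z - 1 / z = (z\<^sup>2 - 1) / z" using z0 by (simp add: field_simps power2_eq_square)
  define e where "e = (z\<^sup>2 * (- 2 / z ^ 3) + C_coef \<alpha> N z * (1 + 1 / z\<^sup>2)) / (z - 1 / z)
    - (\<Sum>u\<in>?U. 2 * ?c * u * z\<^sup>2 / (u - z\<^sup>2)\<^sup>2) - of_real (real N * (2 * \<alpha> + 1) + 1)"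
  have key: "H_hat \<alpha> N g z = z\<^sup>2 * deriv (deriv g) z + C_hat \<alpha> N z * deriv g z
      + (\<Sum>u\<in>?U. Bh u * g (u / z)) + e * g z"
    if g: "g holomorphic_on -{0}" for g
  proof -
    let ?h = "\<lambda>w. (w - 1 / w) * g w"
    have h: "?h holomorphic_on -{0}" by (intro holomorphic_intros g) auto
    have factor: "((\<lambda>w. w - 1 / w) has_field_derivative 1 + 1 / w\<^sup>2) (at w)"
      "((\<lambda>w. 1 + 1 / w\<^sup>2) has_field_derivative - 2 / w ^ 3) (at w)" if "w \<noteq> 0" for w :: complex
      using that by (auto intro!: derivative_eq_intros
          simp: power2_eq_square power3_eq_cube field_simps)
    note dg = punctured_plane_derivatives[OF g]
    have h1: "deriv ?h w = (1 + 1 / w\<^sup>2) * g w + deriv g w * (w - 1 / w)" if "w \<noteq> 0" for w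
      by (intro DERIV_imp_deriv DERIV_mult factor dg that)
    have "deriv (deriv ?h) z = deriv (\<lambda>w. (1 + 1 / w\<^sup>2) * g w + deriv g w * (w - 1 / w)) z"
      by (rule deriv_cong_ev[OF _ refl]) (use h1 z0 in \<open>auto intro: eventually_mono[OF t1_space_nhds]\<close>)
    also have "\<dots> = ((- 2 / z ^ 3) * g z + deriv g z * (1 + 1 / z\<^sup>2))
        + (deriv (deriv g) z * (z - 1 / z) + (1 + 1 / z\<^sup>2) * deriv g z)"
      by (intro DERIV_imp_deriv DERIV_add DERIV_mult factor dg z0)
    finally have h2: "deriv (deriv ?h) z = ((- 2 / z ^ 3) * g z + deriv g z * (1 + 1 / z\<^sup>2))
        + (deriv (deriv g) z * (z - 1 / z) + (1 + 1 / z\<^sup>2) * deriv g z)" .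
    define d where "d = z - 1 / z"
    have d0: "d \<noteq> 0" using z0 z1 by (simp add: d_def zz)
    have "(\<Sum>u\<in>?U. 2 * ?c * u * z\<^sup>2 / (u - z\<^sup>2)\<^sup>2 * (?h (u / z) - ?h z))
        = (\<Sum>u\<in>?U. d * (Bh u * g (u / z)) - 2 * ?c * u * z\<^sup>2 / (u - z\<^sup>2)\<^sup>2 * (d * g z))"
    proof (rule sum.cong)
      fix u assume u: "u \<in> ?U"
      have u0: "u \<noteq> 0" using unity_roots_nonzero[OF N u] .
      have "u / z - 1 / (u / z) = d * ((u\<^sup>2 - z\<^sup>2) / (u * (z\<^sup>2 - 1)))"
        unfolding d_def zz using u0 z0 z1 by (simp add: divide_simps) (simp add: algebra_simps power2_eq_square)
      then have "?h (u / z) = d * ((u\<^sup>2 - z\<^sup>2) / (u * (z\<^sup>2 - 1))) * g (u / z)"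
        by (simp only:)
      then show "2 * ?c * u * z\<^sup>2 / (u - z\<^sup>2)\<^sup>2 * (?h (u / z) - ?h z)
          = d * (Bh u * g (u / z)) - 2 * ?c * u * z\<^sup>2 / (u - z\<^sup>2)\<^sup>2 * (d * g z)"
        unfolding Bh_def d_def[symmetric] by (simp only: right_diff_distrib mult_ac)
    qed simp
    also have "\<dots> = d * (\<Sum>u\<in>?U. Bh u * g (u / z)) - (\<Sum>u\<in>?U. 2 * ?c * u * z\<^sup>2 / (u - z\<^sup>2)\<^sup>2) * (d * g z)"
      by (simp only: sum_subtractf sum_distrib_left sum_distrib_right)
    finally have S: "(\<Sum>u\<in>?U. 2 * ?c * u * z\<^sup>2 / (u - z\<^sup>2)\<^sup>2 * (?h (u / z) - ?h z))
        = d * (\<Sum>u\<in>?U. Bh u * g (u / z)) - (\<Sum>u\<in>?U. 2 * ?c * u * z\<^sup>2 / (u - z\<^sup>2)\<^sup>2) * (d * g z)" .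
    have C: "C_hat \<alpha> N z = C_coef \<alpha> N z + 2 * z\<^sup>2 * (1 + 1 / z\<^sup>2) / d"
      unfolding C_hat_def d_def zz using z0 z1 by (simp add: divide_simps)
    define b where "b = 1 + 1 / z\<^sup>2"
    define t where "t = (- 2 / z ^ 3)"
    define B where "B = (\<Sum>u\<in>?U. 2 * ?c * u * z\<^sup>2 / (u - z\<^sup>2)\<^sup>2)"
    show ?thesis
      unfolding H_hat_def H_op_second_order[OF N h z] S h2 h1[OF z0] e_def C
      unfolding b_def[symmetric] d_def[symmetric] t_def[symmetric] B_def[symmetric]
      using d0 by (simp add: field_simps)
  qed
  have Q1: "H_hat \<alpha> N (\<lambda>_. 1) z = 0"
    using H_hat_sieved_Q[OF N \<alpha> z, of 0] by (simp add: sieved_Q_0)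
  then have e: "e = - (\<Sum>u\<in>?U. Bh u)"
    using key[of "\<lambda>_. 1"] by (simp add: eq_neg_iff_add_eq_0 add.commute)
  have "(\<Sum>k=0..<N. B_hat \<alpha> N k z * (R_op N k f z - f z)) = (\<Sum>u\<in>?U. Bh u * (f (u / z) - f z))"
    unfolding B_hat_def B_coef_def R_op_def Bh_def
    using sum_q_root_eq_sum_unity_roots[OF N, of "\<lambda>u. (u\<^sup>2 - z\<^sup>2) / (u * (z\<^sup>2 - 1)) *
      (2 * ?c * u * z\<^sup>2 / (u - z\<^sup>2)\<^sup>2) * (f (u / z) - f z)"]
    by (simp add: power_mult mult.commute[of 2])
  then show ?thesis
    unfolding H_hat_R_def key[OF f] e
    by (simp add: right_diff_distrib sum_subtractf sum_distrib_right)
qed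

lemma H_hat_R_eq_H_hat_T:
  assumes N: "N \<ge> 1" and sym: "\<And>w. w \<noteq> 0 \<Longrightarrow> f w = f (1 / w)" and "z \<noteq> 0"
  shows "H_hat_R \<alpha> N f z = H_hat_T \<alpha> N f z"
proof -
  have "R_op N k f z = T_op N (- int k) f z" for k
  proof -
    have "q_root N \<noteq> 0" by (simp add: q_root_def)
    then show ?thesis
      using sym[of "q_root N ^ k / z"] assms(3) by (simp add: R_op_def T_op_def power_int_minus divide_inverse mult.commute)
  qed
  moreover have "R_op N 0 f z = f z" using sym[OF assms(3)] by (simp add: R_op_def)
  moreover have "{0..<N} = insert 0 {1..<N}" using N by auto
  ultimately show ?thesis by (simp add: H_hat_R_def H_hat_T_def)
qed

theorem proposition7:
  fixes N :: nat and \<alpha> :: real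
  assumes "N \<ge> 1" and "\<alpha> > -1"
  shows "(\<forall>(n::nat) z. z \<noteq> 0 \<and> z ^ (2 * N) \<noteq> 1 \<longrightarrow>
            H_hat \<alpha> N (\<lambda>w. poly (sieved_Q \<alpha> N n) (w + 1 / w)) z =
              complex_of_real (real n * (real n + (2 * \<alpha> + 1) * real N + 2))
                * poly (sieved_Q \<alpha> N n) (z + 1 / z))
       \<and> (\<forall>f z. symmetric_laurent f \<and> z \<noteq> 0 \<and> z ^ (2 * N) \<noteq> 1 \<longrightarrow>
            H_hat \<alpha> N f z = H_hat_R \<alpha> N f z \<and> H_hat \<alpha> N f z = H_hat_T \<alpha> N f z)"
proof (intro conjI allI impI)
  fix n :: nat and z :: complex
  assume "z \<noteq> 0 \<and> z ^ (2 * N) \<noteq> 1"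
  then show "H_hat \<alpha> N (\<lambda>w. poly (sieved_Q \<alpha> N n) (w + 1 / w)) z =
      complex_of_real (real n * (real n + (2 * \<alpha> + 1) * real N + 2)) * poly (sieved_Q \<alpha> N n) (z + 1 / z)"
    by (intro H_hat_sieved_Q assms) (simp add: regular_points_def)
next
  fix f :: "complex \<Rightarrow> complex" and z :: complex
  assume fz: "symmetric_laurent f \<and> z \<noteq> 0 \<and> z ^ (2 * N) \<noteq> 1"
  then show R: "H_hat \<alpha> N f z = H_hat_R \<alpha> N f z"
    by (intro H_hat_second_order assms laurent_polynomial_holomorphic)
       (auto simp: regular_points_def symmetric_laurent_def)
  have sym: "f w = f (1 / w)" if "w \<noteq> 0" for w
    using fz that unfolding symmetric_laurent_def by blast
  have "z \<noteq> 0" using fz by blast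
  with sym show "H_hat \<alpha> N f z = H_hat_T \<alpha> N f z"
    unfolding R by (rule H_hat_R_eq_H_hat_T[OF assms(1)])
qed

end
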